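(* Let $k\ge 3$ and let $u,v$ be factors of $\mathbf{t}$ of the same length $n\ge 2^k-1$. Then $u\sim_k v$ if and only if $(p_u,s_u)\equiv_k(p_v,s_v)$.
   Context: $A=\{0,1\}$, $\varphi(0)=01$, $\varphi(1)=10$; $\mathbf{t}$ is the fixed point of $\varphi$ starting with $0$, with letters indexed from $0$, and $\mathbf{t}_{[i,j)}$ is its factor at positions $i,\ldots,j-1$. $\bar a$ denotes the complement of a letter $a$. $\binom{u}{x}$ is the number of occurrences of $x$ as a subword (subsequence) of $u$; $u\sim_k v$ means $\binom{u}{x}=\binom{v}{x}$ for all $x\in A^{\le k}$. For a factor $u$ of $\mathbf{t}$, $\mathrm{Cut}_k(u)=\{([i,i+|u|]\cap 2^k\mathbb{N})-i : i\in\mathbb{N},\ u=\mathbf{t}_{[i,i+|u|)}\}$. If $|u|\ge 2^k-1$ and $C\in\mathrm{Cut}_k(u)$, there are unique words $p,s$ and $v'$ with $u=p\varphi^k(v')s$, $|p|=\min C$, $|s|=|u|-\max C$, where $p$ is either empty or a proper suffix of $\varphi^k(a)$ for some letter $a$, and $s$ is either empty or a proper prefix of $\varphi^k(b)$ for some letter $b$; $(p,s)$ is the factorization of order $k$ of $u$ associated with $C$. $(p_u,s_u)$ denotes the factorization of order $k$ of $u$ with $|p_u|$ minimal. The relation $\equiv_k$ on pairs in $A^{<2^k}\times A^{<2^k}$: $(p_1,s_1)\equiv_k(p_2,s_2)$ iff there is $a\in A$ such that either (1) $|p_1|+|s_1|=|p_2|+|s_2|$ and one of: (a) $(p_1,s_1)=(p_2,s_2)$;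 (b) $(p_1,\varphi^{k-1}(a)s_1)=(p_2\varphi^{k-1}(a),s_2)$; (c) $(p_2,\varphi^{k-1}(a)s_2)=(p_1\varphi^{k-1}(a),s_1)$; (d) $(p_1,s_1)=(s_2,p_2)=(\varphi^{k-1}(a),\varphi^{k-1}(\bar a))$; or (2) $\bigl||p_1|+|s_1|-(|p_2|+|s_2|)\bigr|=2^k$ and one of: (a) $(p_1,s_1)=(p_2\varphi^{k-1}(a),\varphi^{k-1}(\bar a)s_2)$; (b) $(p_2,s_2)=(p_1\varphi^{k-1}(a),\varphi^{k-1}(\bar a)s_1)$. *)

theory Defs
  imports "HOL-Library.Sublist"
begin

text \<open>The alphabet $A$ is \<^typ>\<open>bool\<close>, with \<^term>\<open>False\<close> for the letter 0 and \<^term>\<open>True\<close> for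
  the letter 1; the complement of a letter is \<^term>\<open>Not\<close>.\<close>

type_synonym word = "bool list"

definition phi :: "word \<Rightarrow> word" where
  "phi w = concat (map (\<lambda>a. [a, \<not> a]) w)"

text \<open>The words \<^term>\<open>(phi ^^ n) [False]\<close> have length $2^n > n$ and each one is a prefix of the
  next; \<open>tm\<close> is their limit. See \<open>tm_0\<close> and \<open>phi_tm_prefix\<close> below.\<close>

definition tm :: "nat \<Rightarrow> bool" where
  "tm n = ((phi ^^ n) [False]) ! n"

definition tm_factor :: "nat \<Rightarrow> nat \<Rightarrow> word" where
  "tm_factor i j = map tm [i..<j]"

definition is_tm_factor :: "word \<Rightarrow> bool" where
  "is_tm_factor u \<longleftrightarrow> (\<exists>i. u = tm_factor i (i + length u))"

text \<open>An occurrence of \<open>x\<close> as a subword is a set of positions of \<open>u\<close>.\<close>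

definition subword_count :: "word \<Rightarrow> word \<Rightarrow> nat" where
  "subword_count u x = card {I. I \<subseteq> {..<length u} \<and> nths u I = x}"

definition binom_equiv :: "nat \<Rightarrow> word \<Rightarrow> word \<Rightarrow> bool" where
  "binom_equiv k u v \<longleftrightarrow> (\<forall>x. length x \<le> k \<longrightarrow> subword_count u x = subword_count v x)"

definition Cut :: "nat \<Rightarrow> word \<Rightarrow> nat set set" where
  "Cut k u = {(\<lambda>m. m - i) ` ({i..i + length u} \<inter> {m. 2 ^ k dvd m}) | i.
      u = tm_factor i (i + length u)}"

text \<open>\<open>is_factorization k u C (p, s)\<close>: the pair is the factorization of order \<open>k\<close> of \<open>u\<close> associated
  with \<open>C\<close>. Meaningful only for \<open>length u \<ge> 2 ^ k - 1\<close>, which ensures that \<open>C\<close> is nonempty.\<close>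

definition is_factorization :: "nat \<Rightarrow> word \<Rightarrow> nat set \<Rightarrow> word \<times> word \<Rightarrow> bool" where
  "is_factorization k u C = (\<lambda>(p, s). C \<in> Cut k u \<and>
     (\<exists>v'. u = p @ (phi ^^ k) v' @ s) \<and>
     length p = Min C \<and> length s = length u - Max C \<and>
     (p = [] \<or> (\<exists>a. strict_suffix p ((phi ^^ k) [a]))) \<and>
     (s = [] \<or> (\<exists>b. strict_prefix s ((phi ^^ k) [b]))))"

text \<open>The pair $(p_u, s_u)$; see \<open>ex1_min_factorization\<close> for its existence and uniqueness.\<close>

definition min_factorization :: "nat \<Rightarrow> word \<Rightarrow> word \<times> word" where
  "min_factorization k u =
     (THE ps. is_arg_min (\<lambda>(p, s). length p) (\<lambda>ps. \<exists>C. is_factorization k u C ps) ps)"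

definition pair_equiv :: "nat \<Rightarrow> word \<times> word \<Rightarrow> word \<times> word \<Rightarrow> bool" where
  "pair_equiv k = (\<lambda>(p1, s1) (p2, s2).
     length p1 < 2 ^ k \<and> length s1 < 2 ^ k \<and> length p2 < 2 ^ k \<and> length s2 < 2 ^ k \<and>
     (\<exists>a. let f = (phi ^^ (k - 1)) [a]; g = (phi ^^ (k - 1)) [\<not> a] in
       (length p1 + length s1 = length p2 + length s2 \<and>
         ((p1, s1) = (p2, s2) \<or>
          (p1, f @ s1) = (p2 @ f, s2) \<or>
          (p2, f @ s2) = (p1 @ f, s1) \<or>
          ((p1, s1) = (s2, p2) \<and> (s2, p2) = (f, g)))) \<or>
       (\<bar>(int (length p1) + int (length s1)) - (int (length p2) + int (length s2))\<bar> = 2 ^ k \<and>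
         ((p1, s1) = (p2 @ f, g @ s2) \<or>
          (p2, s2) = (p1 @ f, g @ s1)))))"


lemma phi_Nil [simp]: "phi [] = []"
  and phi_Cons [simp]: "phi (a # w) = a # (\<not> a) # phi w"
  and phi_append [simp]: "phi (u @ v) = phi u @ phi v"
  by (simp_all add: phi_def)

lemma length_phi [simp]: "length (phi w) = 2 * length w"
  by (induction w) auto

lemma phi_funpow_Nil [simp]: "(phi ^^ k) [] = []"
  by (induction k) auto

lemma length_phi_funpow [simp]: "length ((phi ^^ k) w) = 2 ^ k * length w"
  by (induction k) auto

lemma phi_funpow_append: "(phi ^^ k) (u @ v) = (phi ^^ k) u @ (phi ^^ k) v"
  by (induction k) auto

lemma phi_map_Not: "phi (map Not w) = map Not (phi w)"
  by (induction w) auto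

lemma phi_funpow_map_Not: "(phi ^^ k) (map Not w) = map Not ((phi ^^ k) w)"
  by (induction k) (auto simp: phi_map_Not)

lemma phi_funpow_Suc_False:
  "(phi ^^ Suc n) [False] = (phi ^^ n) [False] @ map Not ((phi ^^ n) [False])"
proof -
  have "(phi ^^ Suc n) [False] = (phi ^^ n) ([False] @ map Not [False])"
    by (simp add: funpow_swap1)
  then show ?thesis
    by (simp only: phi_funpow_append phi_funpow_map_Not)
qed

lemma phi_nth: "i < length w \<Longrightarrow> phi w ! (2 * i) = w ! i \<and> phi w ! (2 * i + 1) = (\<not> w ! i)"
proof (induction w arbitrary: i)
  case (Cons a w)
  then show ?case by (cases i) auto
qed simp

lemma phi_funpow_nth_mono:
  assumes "m \<le> n" "i < 2 ^ m"
  shows "((phi ^^ n) [False]) ! i = ((phi ^^ m) [False]) ! i"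
  using assms(1)
proof (induction n rule: dec_induct)
  case (step n)
  have "i < 2 ^ n"
    using step.hyps(1) assms(2) by (meson le_trans not_le one_le_numeral power_increasing)
  then have "i < length ((phi ^^ n) [False])"
    by simp
  then show ?case
    using step.IH unfolding phi_funpow_Suc_False nth_append by (simp only: if_True)
qed simp

lemma tm_nth:
  assumes "i < 2 ^ n"
  shows "tm i = ((phi ^^ n) [False]) ! i"
  using phi_funpow_nth_mono[of i n i] phi_funpow_nth_mono[of n i i] assms
  by (cases "i \<le> n") (auto simp: tm_def)

lemma tm_0: "tm 0 = False"
  by (simp add: tm_def)

lemma tm_double: "tm (2 * i) = tm i" "tm (2 * i + 1) = (\<not> tm i)"
proof -
  have i: "i < 2 ^ i"
    by simp
  then have i': "2 * i < 2 ^ Suc i" "2 * i + 1 < 2 ^ Suc i"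
    by (auto simp only: power_Suc)
  have "i < length ((phi ^^ i) [False])"
    using i by simp
  from phi_nth[OF this] show "tm (2 * i) = tm i" "tm (2 * i + 1) = (\<not> tm i)"
    using tm_nth[OF i'(1)] tm_nth[OF i'(2)] tm_nth[OF i] by simp_all
qed

lemma phi_tm_factor:
  assumes "i \<le> j"
  shows "phi (tm_factor i j) = tm_factor (2 * i) (2 * j)"
  using assms
proof (induction j rule: dec_induct)
  case (step j)
  then show ?case
    using tm_double[of j] by (simp add: tm_factor_def)
qed (simp add: tm_factor_def)

lemma phi_tm_prefix: "phi (map tm [0..<n]) = map tm [0..<2 * n]"
  using phi_tm_factor[of 0 n] by (simp add: tm_factor_def)

lemma phi_funpow_tm_factor:
  "i \<le> j \<Longrightarrow> (phi ^^ k) (tm_factor i j) = tm_factor (2 ^ k * i) (2 ^ k * j)"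
  by (induction k) (auto simp: phi_tm_factor mult.assoc)

lemma length_tm_factor [simp]: "length (tm_factor i j) = j - i"
  by (simp add: tm_factor_def)

lemma tm_factor_append: "i \<le> j \<Longrightarrow> j \<le> l \<Longrightarrow> tm_factor i l = tm_factor i j @ tm_factor j l"
  using upt_add_eq_append[of i j "l - j"] by (simp add: tm_factor_def)

lemma tm_factor_block: "tm_factor (2 ^ k * q) (2 ^ k * Suc q) = (phi ^^ k) [tm q]"
  using phi_funpow_tm_factor[of q "Suc q" k] by (simp add: tm_factor_def)

lemma ex_factorization:
  assumes "is_tm_factor u" "length u \<ge> 2 ^ k - 1"
  shows "\<exists>C ps. is_factorization k u C ps"
proof -
  define n where "n = length u"
  obtain i where u: "u = tm_factor i (i + n)"
    using assms(1) by (auto simp: is_tm_factor_def n_def)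
  define N :: nat where "N = 2 ^ k"
  have N: "N > 0" "N \<le> n + 1"
    using assms(2) by (auto simp: N_def n_def)
  define D where "D = {i..i + n} \<inter> {m. N dvd m}"
  define C where "C = (\<lambda>m. m - i) ` D"
  define q where "q = (i + N - 1) div N"
  define r where "r = (i + n) div N"
  have q1: "i \<le> N * q" and q2: "N * q < i + N"
  proof -
    have "N * q + (i + N - 1) mod N = i + N - 1"
      by (simp add: q_def)
    moreover have "(i + N - 1) mod N < N"
      using N(1) by simp
    ultimately show "i \<le> N * q" "N * q < i + N"
      using N(1) by linarith+
  qed
  have r1: "N * r \<le> i + n" and r2: "i + n < N * r + N"
  proof -
    have "N * r + (i + n) mod N = i + n"
      by (simp add: r_def)
    moreover have "(i + n) mod N < N"
      using N(1) by simp
    ultimately show "N * r \<le> i + n" "i + n < N * r + N"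
      by linarith+
  qed
  have "N * q < N * Suc r"
    using q2 r2 N(2) by (simp add: r_def q_def)
  then have qr: "q \<le> r"
    unfolding mult_less_cancel1 by simp
  then have Nqr: "N * q \<le> N * r"
    by simp
  then have iq: "N * q \<le> i + n" "i \<le> N * r"
    using q1 r1 by linarith+
  have bounds: "N * q \<le> m \<and> m \<le> N * r" if "m \<in> D" for m
  proof -
    obtain d where d: "m = N * d"
      using \<open>m \<in> D\<close> by (auto simp: D_def)
    have im: "i \<le> m" "m \<le> i + n"
      using that by (auto simp: D_def)
    have "N * q < N * Suc d" "N * d < N * Suc r"
      using q2 r2 im d by simp_all
    then have "q \<le> d" "d \<le> r"
      unfolding mult_less_cancel1 by simp_all
    then show ?thesis
      by (simp add: d)
  qed
  have finD: "finite D"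
    by (simp add: D_def)
  have mem: "N * q \<in> D" "N * r \<in> D"
    using q1 r1 iq by (auto simp: D_def)
  have minC: "Min C = N * q - i"
    unfolding C_def using finD mem bounds by (intro Min_eqI) (auto intro: diff_le_mono)
  have maxC: "Max C = N * r - i"
    unfolding C_def using finD mem bounds by (intro Max_eqI) (auto intro: diff_le_mono)
  have CCut: "C \<in> Cut k u"
    using u unfolding Cut_def C_def D_def N_def n_def by blast
  define p where "p = tm_factor i (N * q)"
  define s where "s = tm_factor (N * r) (i + n)"
  have dec: "u = p @ (phi ^^ k) (tm_factor q r) @ s"
    using tm_factor_append[of i "N * q" "i + n"] tm_factor_append[of "N * q" "N * r" "i + n"]
      phi_funpow_tm_factor[OF qr, of k] q1 r1 Nqr iq
    by (simp add: u p_def s_def N_def)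
  have psuf: "p = [] \<or> (\<exists>a. strict_suffix p ((phi ^^ k) [a]))"
  proof (cases "q = 0")
    case False
    then obtain q' where q': "q = Suc q'"
      by (cases q) auto
    have "tm_factor (N * q') (N * q) = tm_factor (N * q') i @ p"
      unfolding p_def using q1 q2 q' by (intro tm_factor_append) auto
    then have "(phi ^^ k) [tm q'] = tm_factor (N * q') i @ p"
      using tm_factor_block[of k q'] by (simp add: N_def q')
    moreover have "tm_factor (N * q') i \<noteq> []"
      using q2 q' by (simp add: tm_factor_def)
    ultimately have "strict_suffix p ((phi ^^ k) [tm q'])"
      by (auto simp: strict_suffix_def suffix_def)
    then show ?thesis by blast
  qed (simp add: p_def tm_factor_def)
  have "tm_factor (N * r) (N * Suc r) = s @ tm_factor (i + n) (N * Suc r)"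
    unfolding s_def using r1 r2 by (intro tm_factor_append) auto
  then have "(phi ^^ k) [tm r] = s @ tm_factor (i + n) (N * Suc r)"
    using tm_factor_block[of k r] by (simp add: N_def)
  moreover have "tm_factor (i + n) (N * Suc r) \<noteq> []"
    using r2 N(1) by (simp add: tm_factor_def)
  ultimately have "strict_prefix s ((phi ^^ k) [tm r])"
    by (auto simp: strict_prefix_def)
  moreover have "length p = Min C" "length s = length u - Max C"
    using minC maxC q1 r1 iq by (auto simp: p_def s_def n_def[symmetric])
  ultimately have "is_factorization k u C (p, s)"
    using CCut dec psuf by (auto simp: is_factorization_def)
  then show ?thesis by blast
qed

lemma is_factorization_length_less:
  assumes "is_factorization k u C (p, s)"
  shows "length p < 2 ^ k" "length s < 2 ^ k"
proof -
  have *: "length p < 2 ^ k" if "strict_suffix p ((phi ^^ k) [a])" for a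
    using suffix_length_less[OF that] by simp
  have **: "length s < 2 ^ k" if "strict_prefix s ((phi ^^ k) [a])" for a
    using prefix_length_less[OF that] by simp
  have "p = [] \<or> (\<exists>a. strict_suffix p ((phi ^^ k) [a]))"
    "s = [] \<or> (\<exists>b. strict_prefix s ((phi ^^ k) [b]))"
    using assms unfolding is_factorization_def prod.case by blast+
  then show "length p < 2 ^ k" "length s < 2 ^ k"
    using * ** by (elim disjE exE; simp)+
qed

lemma is_factorization_unique:
  assumes "is_factorization k u C (p, s)" "is_factorization k u C' (p', s')"
    and "length p = length p'"
  shows "(p, s) = (p', s')"
proof -
  obtain v v' where v: "u = p @ (phi ^^ k) v @ s" and v': "u = p' @ (phi ^^ k) v' @ s'"
    using assms(1,2) unfolding is_factorization_def prod.case by blast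
  have eq: "p = p'" "(phi ^^ k) v @ s = (phi ^^ k) v' @ s'"
    using trans[OF v[symmetric] v'] assms(3) by simp_all
  have "2 ^ k * length v + length s = 2 ^ k * length v' + length s'"
    using arg_cong[OF eq(2), of length] by simp
  then have "(2 ^ k * length v + length s) mod 2 ^ k = (2 ^ k * length v' + length s') mod 2 ^ k"
    by simp
  then have "length s = length s'"
    using is_factorization_length_less(2)[OF assms(1)] is_factorization_length_less(2)[OF assms(2)]
    by simp
  then show ?thesis
    using eq by simp
qed

lemma ex1_min_factorization:
  assumes "is_tm_factor u" "length u \<ge> 2 ^ k - 1"
  shows "\<exists>!ps. is_arg_min (\<lambda>(p, s). length p) (\<lambda>ps. \<exists>C. is_factorization k u C ps) ps"
proof -
  let ?f = "\<lambda>(p, s). length p :: nat" and ?P = "\<lambda>ps. \<exists>C. is_factorization k u C ps"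
  obtain ps0 where "?P ps0"
    using ex_factorization[OF assms] by blast
  then have ex: "is_arg_min ?f ?P (arg_min ?f ?P)"
    using arg_min_nat_lemma[of ?P ps0 ?f] by (auto simp: is_arg_min_linorder)
  have "ps = ps'" if "is_arg_min ?f ?P ps" "is_arg_min ?f ?P ps'" for ps ps'
  proof -
    obtain p s p' s' where ps: "ps = (p, s)" "ps' = (p', s')"
      by (cases ps, cases ps')
    have "?f ps \<le> ?f ps'" "?f ps' \<le> ?f ps" "?P ps" "?P ps'"
      using that unfolding is_arg_min_linorder by blast+
    then show ?thesis
      using is_factorization_unique[of k u _ p s _ p' s'] ps by auto
  qed
  with ex show ?thesis by blast
qed

end

theory Submission
  imports Defs "HOL-Library.Poly_Mapping"
begin

text \<open>Send a word \<open>u\<close> to the product of the \<open>1 + X_a\<close> over its letters \<open>a\<close>, a polynomial in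
  noncommuting variables whose coefficients are the subword counts of \<open>u\<close>; then \<open>u \<sim>_k v\<close> means
  that the images agree modulo terms of degree greater than \<open>k\<close>. The difference \<open>L\<close> of the images
  of \<open>phi^k(c)\<close> and \<open>phi^k(\<not> c)\<close> starts exactly in degree \<open>k + 1\<close>: passing from \<open>k\<close> to \<open>k + 1\<close> is
  taking the commutator with the image of a block, and the coefficient of \<open>c (\<not> c)^k\<close> stays
  positive. Modulo degree \<open>k + 2\<close> the image of \<open>p phi^k(w) s\<close> is thus determined by \<open>p\<close>, \<open>s\<close>, the
  length of \<open>w\<close> and an integer multiple of \<open>L\<close> that counts the letters \<open>c\<close> in \<open>w\<close>.

  That equivalent pairs give \<open>k\<close>-binomially equivalent words follows because blocks of order \<open>k - 1\<close>
  commute with blocks of order \<open>k\<close> up to degree \<open>k\<close>. The converse is an induction on the order,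
  starting from the trivial order 0. If \<open>u \<sim>_{k+1} v\<close>, then by induction the pairs of order \<open>k\<close> are
  equivalent. Each kind of equivalence other than equality forces, by comparing multiples of \<open>L\<close>, a
  run of equal letters in the Thue--Morse word that is too long; equality of the pairs forces
  equally many letters 0 in the two words of blocks, and this determines the pairs of order
  \<open>k + 1\<close> up to equivalence.\<close>

section \<open>The Magnus transform\<close>

text \<open>The product of \<open>poly_mapping\<close> is convolution along \<open>+\<close> on the
  keys. With concatenation as \<open>+\<close>, finitely supported maps on words form the ring of
  noncommutative polynomials, whose monomials are the words.\<close>

instantiation list :: (type) monoid_add
begin

definition zero_list :: "'a list" where "zero_list = []"

definition plus_list :: "'a list \<Rightarrow> 'a list \<Rightarrow> 'a list" where "plus_list = (@)"

instance
  by standard (simp_all add: zero_list_def plus_list_def)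

end

type_synonym ncpoly = "word \<Rightarrow>\<^sub>0 int"

abbreviation coeff :: "ncpoly \<Rightarrow> word \<Rightarrow> int" where
  "coeff \<equiv> Poly_Mapping.lookup"

definition letter :: "bool \<Rightarrow> ncpoly" where
  "letter a = Poly_Mapping.single [a] 1"

definition magnus :: "word \<Rightarrow> ncpoly" where
  "magnus u = (\<Prod>a\<leftarrow>u. 1 + letter a)"

lemma magnus_Nil [simp]: "magnus [] = 1"
  and magnus_Cons: "magnus (a # u) = (1 + letter a) * magnus u"
  and magnus_append: "magnus (u @ v) = magnus u * magnus v"
  by (simp_all add: magnus_def)

lemma letter_mult_expand:
  "coeff (letter a * f) x = (\<Sum>q. coeff f q when x = a # q)"
proof -
  have "coeff (letter a * f) x
      = (\<Sum>l. (\<Sum>q. coeff f q when x = l @ q) when [a] = l)"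
    unfolding lookup_mult letter_def lookup_single
    by (rule Sum_any.cong) (simp add: plus_list_def when_def)
  then show ?thesis
    by simp
qed

lemma lookup_letter_mult_Nil [simp]: "coeff (letter a * f) [] = 0"
  by (simp add: letter_mult_expand)

lemma lookup_letter_mult_Cons [simp]:
  "coeff (letter a * f) (b # x) = (if a = b then coeff f x else 0)"
  by (auto simp: letter_mult_expand)

lemma lookup_mult_letter_snoc [simp]:
  "coeff (f * letter a) (x @ [b]) = (if a = b then coeff f x else 0)"
proof -
  have "(\<Sum>q. (1 when [a] = q) when x @ [b] = l @ q) = (1 when x = l \<and> a = b :: int)" for l
  proof -
    have "(\<Sum>q. (1 when [a] = q) when x @ [b] = l @ q)
        = (\<Sum>q. (1 when x @ [b] = l @ [a]) when [a] = q :: int)"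
      by (rule Sum_any.cong) (auto simp: when_def)
    then show ?thesis
      by (auto simp: when_def)
  qed
  then have "coeff (f * letter a) (x @ [b]) = (\<Sum>l. coeff f l * (1 when x = l \<and> a = b))"
    unfolding lookup_mult letter_def lookup_single plus_list_def by simp
  also have "\<dots> = (\<Sum>l. (if a = b then coeff f l else 0) when x = l)"
    by (rule Sum_any.cong) (auto simp: when_def)
  finally show ?thesis
    by simp
qed

section \<open>Subword counts as coefficients\<close>

lemma subword_count_Nil: "subword_count [] x = (if x = [] then 1 else 0)"
proof -
  have "{I. I \<subseteq> {..<length ([]::word)} \<and> nths [] I = x} = (if x = [] then {{}} else {})"
    by auto
  then show ?thesis
    unfolding subword_count_def by simp
qed

text \<open>Split the position sets by whether they contain 0. Those that do not are shifted
  position sets in \<open>u\<close> for \<open>x\<close>; those that do fix the first letter of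
  \<open>x\<close> and leave a shifted position set for its tail.\<close>

lemma subword_count_Cons:
  "subword_count (a # u) x = subword_count u x +
     (case x of [] \<Rightarrow> 0 | b # y \<Rightarrow> if a = b then subword_count u y else 0)"
proof -
  define S where "S u x = {I. I \<subseteq> {..<length u} \<and> nths u I = x}" for u x :: word
  have finS: "finite (S u x)" for u x
    unfolding S_def by (rule finite_subset[of _ "Pow {..<length u}"]) auto
  have A: "{I \<in> S (a # u) x. 0 \<notin> I} = (`) Suc ` S u x"
  proof (intro equalityI subsetI)
    fix I assume "I \<in> {I \<in> S (a # u) x. 0 \<notin> I}"
    then have I: "I \<subseteq> {..<Suc (length u)}" "nths (a # u) I = x" "0 \<notin> I"
      by (auto simp: S_def)
    have "I = Suc ` {j. Suc j \<in> I}"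
    proof (intro equalityI subsetI)
      fix i assume "i \<in> I"
      with I(3) show "i \<in> Suc ` {j. Suc j \<in> I}"
        by (cases i) auto
    qed auto
    moreover have "{j. Suc j \<in> I} \<in> S u x"
      using I by (auto simp: S_def nths_Cons)
    ultimately show "I \<in> (`) Suc ` S u x"
      by blast
  next
    fix I assume "I \<in> (`) Suc ` S u x"
    then obtain J where J: "I = Suc ` J" "J \<in> S u x"
      by blast
    have "{j. Suc j \<in> I} = J"
      using J by auto
    with J show "I \<in> {I \<in> S (a # u) x. 0 \<notin> I}"
      by (auto simp: S_def nths_Cons)
  qed
  have B: "{I \<in> S (a # u) (a # y). 0 \<in> I} = (\<lambda>J. insert 0 (Suc ` J)) ` S u y" for y
  proof (intro equalityI subsetI)
    fix I assume "I \<in> {I \<in> S (a # u) (a # y). 0 \<in> I}"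
    then have I: "I \<subseteq> {..<Suc (length u)}" "nths (a # u) I = a # y" "0 \<in> I"
      by (auto simp: S_def)
    have "I = insert 0 (Suc ` {j. Suc j \<in> I})"
    proof (intro equalityI subsetI)
      fix i assume "i \<in> I"
      then show "i \<in> insert 0 (Suc ` {j. Suc j \<in> I})"
        by (cases i) auto
    qed (use I in auto)
    moreover have "{j. Suc j \<in> I} \<in> S u y"
      using I by (auto simp: S_def nths_Cons)
    ultimately show "I \<in> (\<lambda>J. insert 0 (Suc ` J)) ` S u y"
      by blast
  next
    fix I assume "I \<in> (\<lambda>J. insert 0 (Suc ` J)) ` S u y"
    then obtain J where J: "I = insert 0 (Suc ` J)" "J \<in> S u y"
      by blast
    have "{j. Suc j \<in> I} = J"
      using J by auto
    with J show "I \<in> {I \<in> S (a # u) (a # y). 0 \<in> I}"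
      by (auto simp: S_def nths_Cons)
  qed
  have B': "{I \<in> S (a # u) x. 0 \<in> I} = {}" if "\<nexists>y. x = a # y"
    using that by (auto simp: S_def nths_Cons)
  have "card (S (a # u) x) = card ({I \<in> S (a # u) x. 0 \<notin> I} \<union> {I \<in> S (a # u) x. 0 \<in> I})"
    by (rule arg_cong[of _ _ card]) auto
  also have "\<dots> = card {I \<in> S (a # u) x. 0 \<notin> I} + card {I \<in> S (a # u) x. 0 \<in> I}"
    by (intro card_Un_disjoint) (use finS in auto)
  also have "card {I \<in> S (a # u) x. 0 \<notin> I} = card (S u x)"
    unfolding A by (intro card_image inj_onI) (metis inj_Suc inj_image_eq_iff)
  also have "card {I \<in> S (a # u) x. 0 \<in> I}
      = (case x of [] \<Rightarrow> 0 | b # y \<Rightarrow> if a = b then card (S u y) else 0)"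
  proof (cases "\<exists>y. x = a # y")
    case True
    then obtain y where y: "x = a # y" ..
    have "inj_on (\<lambda>J. insert 0 (Suc ` J)) (S u y)"
    proof (rule inj_onI)
      fix I J :: "nat set" assume eq: "insert 0 (Suc ` I) = insert 0 (Suc ` J)"
      have "Suc ` I = insert 0 (Suc ` I) - {0}" "Suc ` J = insert 0 (Suc ` J) - {0}"
        by auto
      with eq show "I = J"
        by (metis inj_Suc inj_image_eq_iff)
    qed
    then show ?thesis
      unfolding y B by (simp add: card_image)
  next
    case False
    then show ?thesis
      by (subst B'[OF False]) (use False in \<open>auto split: list.split\<close>)
  qed
  moreover have "subword_count u x = card (S u x)" for u x
    by (simp add: subword_count_def S_def)
  ultimately show ?thesis
    by presburger
qed

text \<open>Multiplication by \<open>1 + letter a\<close> obeys the recursion of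
  \<open>subword_count_Cons\<close>: the summand 1 skips the first letter, \<open>letter a\<close>
  uses it.\<close>

lemma lookup_magnus: "coeff (magnus u) x = int (subword_count u x)"
proof (induction u arbitrary: x)
  case Nil
  show ?case
    by (simp add: subword_count_Nil lookup_one zero_list_def when_def)
next
  case (Cons a u)
  then show ?case
    by (cases x) (auto simp: magnus_Cons subword_count_Cons distrib_right lookup_add)
qed

section \<open>Congruence modulo words of a given length\<close>

definition order_ge :: "nat \<Rightarrow> ncpoly \<Rightarrow> bool" where
  "order_ge d f \<longleftrightarrow> (\<forall>x \<in> Poly_Mapping.keys f. d \<le> length x)"

lemma order_ge_iff: "order_ge d f \<longleftrightarrow> (\<forall>x. length x < d \<longrightarrow> coeff f x = 0)"
  unfolding order_ge_def Ball_def in_keys_iff by (meson not_le)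

lemma order_ge_0 [simp]: "order_ge d 0" "order_ge 0 f"
  by (simp_all add: order_ge_iff)

lemma order_ge_letter: "order_ge 1 (letter a)"
  by (simp add: order_ge_def letter_def)

lemma order_ge_add: "order_ge d f \<Longrightarrow> order_ge d g \<Longrightarrow> order_ge d (f + g)"
  and order_ge_diff: "order_ge d f \<Longrightarrow> order_ge d g \<Longrightarrow> order_ge d (f - g)"
  by (simp_all add: order_ge_iff lookup_add lookup_minus)

lemma order_ge_mono: "order_ge d f \<Longrightarrow> c \<le> d \<Longrightarrow> order_ge c f"
  by (auto simp: order_ge_def)

lemma order_ge_mult:
  assumes "order_ge c f" "order_ge d g"
  shows "order_ge (c + d) (f * g)"
  unfolding order_ge_def
proof
  fix x assume "x \<in> Poly_Mapping.keys (f * g)"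
  then obtain y z where "x = y + z" "y \<in> Poly_Mapping.keys f" "z \<in> Poly_Mapping.keys g"
    using keys_mult[of f g] by auto
  with assms show "c + d \<le> length x"
    by (simp add: order_ge_def plus_list_def add_mono)
qed

lemma order_ge_mult_left: "order_ge d g \<Longrightarrow> order_ge d (f * g)"
  and order_ge_mult_right: "order_ge d g \<Longrightarrow> order_ge d (g * f)"
  using order_ge_mult[of 0 f d g] order_ge_mult[of d g 0 f] by simp_all

text \<open>The bound is exclusive: agreement in degrees below \<open>d\<close>. Hence
  \<open>k\<close>-binomial equivalence is \<open>eq_upto (Suc k)\<close>.\<close>

definition eq_upto :: "nat \<Rightarrow> ncpoly \<Rightarrow> ncpoly \<Rightarrow> bool" where
  "eq_upto d f g \<longleftrightarrow> order_ge d (f - g)"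

lemma binom_equiv_iff: "binom_equiv k u v \<longleftrightarrow> eq_upto (Suc k) (magnus u) (magnus v)"
  by (auto simp: binom_equiv_def eq_upto_def order_ge_iff lookup_minus lookup_magnus)

lemma eq_upto_refl [simp, intro]: "eq_upto d f f"
  by (simp add: eq_upto_def)

lemma eq_upto_sym: "eq_upto d f g \<Longrightarrow> eq_upto d g f"
  by (simp add: eq_upto_def order_ge_iff lookup_minus)

lemma eq_upto_trans [trans]: "eq_upto d f g \<Longrightarrow> eq_upto d g h \<Longrightarrow> eq_upto d f h"
  by (simp add: eq_upto_def order_ge_iff lookup_minus)

lemma eq_upto_mono: "eq_upto d f g \<Longrightarrow> c \<le> d \<Longrightarrow> eq_upto c f g"
  unfolding eq_upto_def by (rule order_ge_mono)

lemma eq_upto_add: "eq_upto d f f' \<Longrightarrow> eq_upto d g g' \<Longrightarrow> eq_upto d (f + g) (f' + g')"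
  and eq_upto_diff: "eq_upto d f f' \<Longrightarrow> eq_upto d g g' \<Longrightarrow> eq_upto d (f - g) (f' - g')"
  by (simp_all add: eq_upto_def order_ge_iff lookup_minus lookup_add)

lemma eq_upto_mult:
  assumes "eq_upto d f f'" "eq_upto d g g'"
  shows "eq_upto d (f * g) (f' * g')"
proof -
  have "f * g - f' * g' = (f - f') * g + f' * (g - g')"
    by (simp add: algebra_simps)
  then show ?thesis
    using assms unfolding eq_upto_def
    by (simp add: order_ge_add order_ge_mult_left order_ge_mult_right)
qed

section \<open>Polynomials with constant term 1\<close>

definition unital :: "ncpoly \<Rightarrow> bool" where
  "unital g \<longleftrightarrow> eq_upto 1 g 1"

lemma unital_1 [simp]: "unital 1"
  by (simp add: unital_def)

lemma unital_mult: "unital f \<Longrightarrow> unital g \<Longrightarrow> unital (f * g)"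
  unfolding unital_def using eq_upto_mult[of 1 f 1 g 1] by simp

lemma unital_power: "unital f \<Longrightarrow> unital (f ^ n)"
  by (induction n) (simp_all add: unital_mult)

lemma unital_magnus: "unital (magnus u)"
proof (induction u)
  case (Cons a u)
  have "unital (1 + letter a)"
    by (simp add: unital_def eq_upto_def order_ge_def letter_def)
  with Cons show ?case
    by (simp add: magnus_Cons unital_mult)
qed simp

text \<open>The factor \<open>g\<close> is 1 plus terms of positive degree, so it changes
  \<open>f\<close> only above degree \<open>d\<close>. This is how everything that surrounds
  \<open>L\<close> is discarded later.\<close>

lemma mult_unital:
  assumes "order_ge d f" "unital g"
  shows "eq_upto (Suc d) (f * g) f" "eq_upto (Suc d) (g * f) f"
proof -
  have "f * g - f = f * (g - 1)" "g * f - f = (g - 1) * f"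
    by (simp_all add: algebra_simps)
  then show "eq_upto (Suc d) (f * g) f" "eq_upto (Suc d) (g * f) f"
    using assms order_ge_mult[of d f 1 "g - 1"] order_ge_mult[of 1 "g - 1" d f]
    by (simp_all add: unital_def eq_upto_def)
qed

lemma unital_mult_unital:
  assumes "order_ge d f" "unital g" "unital h"
  shows "eq_upto (Suc d) (g * f * h) f"
  using mult_unital(1)[of d "g * f" h] mult_unital(2)[of d f g] assms
  by (blast intro: eq_upto_trans order_ge_mult_left)

lemma magnus_linear:
  "eq_upto 2 (magnus u) (1 + of_nat (count_list u c) * letter c
     + of_nat (count_list u (\<not> c)) * letter (\<not> c))"
proof (induction u)
  case (Cons a u)
  let ?l = "of_nat (count_list u c) * letter c + of_nat (count_list u (\<not> c)) * letter (\<not> c)"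
  have "order_ge 1 ?l"
    by (intro order_ge_add order_ge_mult_left order_ge_letter)
  then have "order_ge 2 (letter a * ?l)"
    using order_ge_mult[OF order_ge_letter, of 1 ?l a] by (simp add: numeral_2_eq_2)
  then have *: "eq_upto 2 ((1 + letter a) * (1 + ?l)) (1 + ?l + letter a)"
    by (simp add: eq_upto_def algebra_simps)
  have "eq_upto 2 (magnus (a # u)) ((1 + letter a) * (1 + ?l))"
    unfolding magnus_Cons using Cons by (intro eq_upto_mult) (simp_all add: add.assoc)
  also note *
  also have "1 + ?l + letter a = 1 + of_nat (count_list (a # u) c) * letter c
     + of_nat (count_list (a # u) (\<not> c)) * letter (\<not> c)"
    by (cases "a = c") (auto simp: algebra_simps)
  finally show ?case .
qed simp

section \<open>The Magnus transform of the blocks of the Thue--Morse morphism\<close>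

abbreviation block :: "nat \<Rightarrow> bool \<Rightarrow> word" where
  "block k c \<equiv> (phi ^^ k) [c]"

definition block_diff :: "nat \<Rightarrow> bool \<Rightarrow> ncpoly" where
  "block_diff k c = magnus (block k c) - magnus (block k (\<not> c))"

lemma block_Suc: "block (Suc k) c = block k c @ block k (\<not> c)"
proof -
  have "block (Suc k) c = (phi ^^ k) ([c] @ [\<not> c])"
    by (simp add: funpow_swap1)
  then show ?thesis
    by (simp only: phi_funpow_append)
qed

lemma phi_funpow_Cons: "(phi ^^ k) (a # w) = block k a @ (phi ^^ k) w"
  using phi_funpow_append[of k "[a]" w] by simp

text \<open>Write \<open>x\<close> and \<open>y\<close> for the images of the two blocks of order
  \<open>k\<close>. Then \<open>x * y - y * x = (x - y) * y - y * (x - y)\<close>, because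
  \<open>y\<close> commutes with itself.\<close>

lemma block_diff_Suc:
  "block_diff (Suc k) c = block_diff k c * magnus (block k (\<not> c))
     - magnus (block k (\<not> c)) * block_diff k c"
  by (simp add: block_diff_def block_Suc magnus_append algebra_simps del: funpow.simps)

text \<open>The commutator with a polynomial of constant term 1 cancels the lowest-degree part and
  so gains one degree. In particular, the two blocks of order \<open>k\<close> are
  \<open>k\<close>-binomially equivalent.\<close>

lemma order_ge_block_diff: "order_ge (Suc k) (block_diff k c)"
proof (induction k)
  case 0
  have "block_diff 0 c = letter c - letter (\<not> c)"
    by (simp add: block_diff_def magnus_Cons)
  then show ?case
    using order_ge_diff[OF order_ge_letter order_ge_letter] by simp
next
  case (Suc k)
  let ?g = "magnus (block k (\<not> c))"
  have "eq_upto (Suc (Suc k)) (block_diff k c * ?g - ?g * block_diff k c)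
      (block_diff k c - block_diff k c)"
    using mult_unital[OF Suc unital_magnus] by (intro eq_upto_diff)
  then show ?case
    by (simp add: eq_upto_def block_diff_Suc del: funpow.simps)
qed


lemma coeff_mult_of_nat_letter_snoc:
  "coeff (f * (of_nat n * letter a)) (x @ [b]) = (if a = b then int n * coeff f x else 0)"
  by (induction n) (auto simp: algebra_simps lookup_add)

lemma coeff_of_nat_letter_mult_Cons:
  "coeff (of_nat n * letter a * f) (b # x) = (if a = b then int n * coeff f x else 0)"
  by (induction n) (auto simp: algebra_simps lookup_add)

text \<open>In degree \<open>k + 2\<close> only the linear part of \<open>magnus u\<close> matters:
  its constant term 1 commutes with \<open>f\<close>, and its terms of degree at least 2 push the
  product to degree \<open>k + 3\<close>.\<close>

lemma coeff_commutator:
  assumes "order_ge (Suc k) f" "length x = k"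
  shows "coeff (f * magnus u - magnus u * f) (a # x @ [b])
     = int (count_list u b) * coeff f (a # x) - int (count_list u a) * coeff f (x @ [b])"
proof -
  define l where "l = of_nat (count_list u a) * letter a
     + of_nat (count_list u (\<not> a)) * letter (\<not> a)"
  define r where "r = magnus u - (1 + l)"
  have "order_ge 2 r"
    using magnus_linear[of u a] by (simp add: r_def l_def eq_upto_def add.assoc)
  then have "order_ge (k + 3) (f * r - r * f)"
    using order_ge_mult[OF assms(1), of 2 r] order_ge_mult[of 2 r "Suc k" f] assms(1)
    by (intro order_ge_diff) (simp_all add: eval_nat_numeral)
  then have "coeff (f * r - r * f) (a # x @ [b]) = 0"
    using assms(2) by (simp add: order_ge_iff)
  moreover have "f * magnus u - magnus u * f = (f * l - l * f) + (f * r - r * f)"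
    by (simp add: r_def algebra_simps)
  moreover have "coeff (f * l) ((a # x) @ [b]) = int (count_list u b) * coeff f (a # x)"
    unfolding l_def distrib_left lookup_add coeff_mult_of_nat_letter_snoc by (cases "a = b") auto
  moreover have "coeff (l * f) (a # x @ [b]) = int (count_list u a) * coeff f (x @ [b])"
    unfolding l_def distrib_right lookup_add coeff_of_nat_letter_mult_Cons by simp
  ultimately show ?thesis
    by (simp add: lookup_add lookup_minus)
qed

lemma count_block_pos: "count_list (block k c) c > 0"
proof (induction k)
  case (Suc k)
  then show ?case
    by (simp add: block_Suc del: funpow.simps)
qed simp

text \<open>The commutator formula involves the coefficients of both words, so the sign of the
  second is carried through the induction. It is -1 for order 0 and 0 afterwards, since the two
  terms of the commutator cancel on a word in a single letter.\<close>

lemma coeff_block_diff: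
  "coeff (block_diff k c) (c # replicate k (\<not> c)) > 0
   \<and> coeff (block_diff k c) (replicate (Suc k) (\<not> c)) \<le> 0"
proof (induction k)
  case 0
  have "block_diff 0 c = letter c - letter (\<not> c)"
    by (simp add: block_diff_def magnus_Cons)
  then show ?case
    by (simp add: letter_def lookup_minus lookup_single when_def)
next
  case (Suc k)
  let ?g = "block k (\<not> c)" and ?L = "block_diff k c"
  have 1: "coeff (block_diff (Suc k) c) (a # replicate k (\<not> c) @ [\<not> c])
     = int (count_list ?g (\<not> c)) * coeff ?L (a # replicate k (\<not> c))
       - int (count_list ?g a) * coeff ?L (replicate k (\<not> c) @ [\<not> c])" for a
    unfolding block_diff_Suc by (rule coeff_commutator[OF order_ge_block_diff]) simp
  have 2: "replicate k (\<not> c) @ [\<not> c] = replicate (Suc k) (\<not> c)"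
    using replicate_append_same[of k "\<not> c"] by simp
  have "int (count_list ?g (\<not> c)) * coeff ?L (c # replicate k (\<not> c)) > 0"
    using Suc count_block_pos by simp
  moreover have "int (count_list ?g c) * coeff ?L (replicate (Suc k) (\<not> c)) \<le> 0"
    using Suc by (simp add: mult_nonneg_nonpos)
  ultimately show ?case
    using 1[of c] 1[of "\<not> c"] unfolding 2 by simp
qed

text \<open>By \<open>coeff_block_diff\<close>, some coefficient of \<open>L\<close> in degree
  \<open>k + 1\<close> is nonzero, so its multiples differ there.\<close>

lemma block_diff_multiple_eq:
  assumes "eq_upto (Suc (Suc k)) (f + of_nat m * block_diff k c) (f + of_nat n * block_diff k c)"
  shows "m = n"
proof -
  have "coeff (of_nat m * block_diff k c) x = coeff (of_nat n * block_diff k c) x"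
    if "length x = Suc k" for x
    using assms that by (simp add: eq_upto_def order_ge_iff lookup_minus lookup_add)
  moreover have "coeff (of_nat n * g) x = int n * coeff g x" for n g x
    by (induction n) (simp_all add: algebra_simps lookup_add)
  ultimately show ?thesis
    using coeff_block_diff[of k c] by (metis length_Cons length_replicate less_irrefl
      mult_right_cancel of_nat_eq_iff)
qed

lemma mult_unital_multiple:
  assumes "order_ge d f" "unital g" "unital h"
  shows "eq_upto (Suc d) (g * (of_nat n * f) * h) (of_nat n * f)"
  using assms by (intro unital_mult_unital order_ge_mult_left)

text \<open>Replace the blocks of \<open>c\<close> by blocks of \<open>\<not> c\<close> one at a
  time. Each replacement costs one \<open>L\<close>, wherever it happens, because everything around
  \<open>L\<close> has constant term 1.\<close>

lemma magnus_phi_funpow: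
  "eq_upto (k + 2) (magnus ((phi ^^ k) w))
     (magnus (block k (\<not> c)) ^ length w + of_nat (count_list w c) * block_diff k c)"
proof (induction w)
  case (Cons a w)
  let ?g = "magnus (block k (\<not> c))" and ?L = "block_diff k c"
  let ?m = "length w" and ?n = "count_list w c"
  have "eq_upto (k + 2) (magnus ((phi ^^ k) (a # w))) (magnus (block k a) * (?g ^ ?m + of_nat ?n * ?L))"
    unfolding phi_funpow_Cons[of k a w] magnus_append using Cons by (intro eq_upto_mult) auto
  also have "magnus (block k a) * (?g ^ ?m + of_nat ?n * ?L)
      = magnus (block k a) * ?g ^ ?m + magnus (block k a) * (of_nat ?n * ?L)"
    by (simp add: distrib_left)
  also have "eq_upto (k + 2) \<dots> (magnus (block k a) * ?g ^ ?m + of_nat ?n * ?L)"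
    using mult_unital_multiple[OF order_ge_block_diff unital_magnus unital_1]
    by (intro eq_upto_add) simp_all
  also have "eq_upto (k + 2) \<dots> (?g ^ Suc ?m + of_nat (if a = c then 1 else 0) * ?L + of_nat ?n * ?L)"
  proof (intro eq_upto_add eq_upto_refl)
    show "eq_upto (k + 2) (magnus (block k a) * ?g ^ ?m)
        (?g ^ Suc ?m + of_nat (if a = c then 1 else 0) * ?L)"
    proof (cases "a = c")
      case True
      have "magnus (block k a) * ?g ^ ?m = ?g ^ Suc ?m + ?L * ?g ^ ?m"
        using True by (simp add: block_diff_def algebra_simps)
      also have "eq_upto (k + 2) \<dots> (?g ^ Suc ?m + ?L)"
        using mult_unital(1)[OF order_ge_block_diff unital_power[OF unital_magnus]]
        by (intro eq_upto_add) simp_all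
      finally show ?thesis
        using True by simp
    next
      case False
      then have "a = (\<not> c)"
        by auto
      then show ?thesis
        by simp
    qed
  qed
  finally show ?case
    by (auto simp: algebra_simps)
qed simp

lemma magnus_factorization:
  "eq_upto (k + 2) (magnus (p @ (phi ^^ k) w @ s))
     (magnus p * magnus (block k (\<not> c)) ^ length w * magnus s
       + of_nat (count_list w c) * block_diff k c)"
proof -
  let ?g = "magnus (block k (\<not> c))" and ?L = "block_diff k c"
  let ?m = "length w" and ?n = "count_list w c"
  have "eq_upto (k + 2) (magnus (p @ (phi ^^ k) w @ s))
      (magnus p * (?g ^ ?m + of_nat ?n * ?L) * magnus s)"
    unfolding magnus_append mult.assoc
    by (intro eq_upto_mult magnus_phi_funpow eq_upto_refl)
  also have "magnus p * (?g ^ ?m + of_nat ?n * ?L) * magnus s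
      = magnus p * ?g ^ ?m * magnus s + magnus p * (of_nat ?n * ?L) * magnus s"
    by (simp add: algebra_simps)
  also have "eq_upto (k + 2) \<dots> (magnus p * ?g ^ ?m * magnus s + of_nat ?n * ?L)"
    using mult_unital_multiple[OF order_ge_block_diff unital_magnus unital_magnus]
    by (intro eq_upto_add) simp_all
  finally show ?thesis .
qed

text \<open>With \<open>g = e' * e\<close> and \<open>L = e * e' - e' * e\<close>, moving
  \<open>e\<close> to the right across one \<open>g\<close> costs \<open>L\<close>, since
  \<open>e * g = g * e + L * e\<close>. Moving \<open>e'\<close> costs \<open>-L\<close>; the second
  statement therefore has the multiple on the other side, so that only natural multiples
  occur.\<close>

lemma magnus_half_block_commute:
  fixes k c m
  defines "e \<equiv> magnus (block k c)" and "e' \<equiv> magnus (block k (\<not> c))"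
    and "g \<equiv> magnus (block (Suc k) (\<not> c))" and "L \<equiv> block_diff (Suc k) c"
  shows "eq_upto (k + 3) (e * g ^ m) (g ^ m * e + of_nat m * L)"
    and "eq_upto (k + 3) (e' * g ^ m + of_nat m * L) (g ^ m * e')"
proof -
  have g: "g = e' * e" and L: "L = e * e' - e' * e"
    by (simp_all add: g_def L_def e_def e'_def block_diff_def block_Suc magnus_append
        del: funpow.simps)
  have unit: "unital e" "unital e'" "unital g"
    by (simp_all add: e_def e'_def g_def unital_magnus del: funpow.simps)
  have Lo: "order_ge (k + 2) L"
    using order_ge_block_diff[of "Suc k" c] by (simp add: L_def)
  have L1: "eq_upto (k + 3) (L * h) L" "eq_upto (k + 3) (h * L) L" if "unital h" for h
    using mult_unital[OF Lo that] by (simp_all add: eval_nat_numeral)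
  have Ln: "eq_upto (k + 3) (h * (of_nat m * L)) (of_nat m * L)" if "unital h" for h m
    using mult_unital_multiple[OF Lo that unital_1] by (simp add: eval_nat_numeral)
  show "eq_upto (k + 3) (e * g ^ m) (g ^ m * e + of_nat m * L)"
  proof (induction m)
    case (Suc m)
    have "e * g ^ Suc m = g * (e * g ^ m) + L * (e * g ^ m)"
      by (simp add: g L algebra_simps)
    also have "eq_upto (k + 3) \<dots> (g * (g ^ m * e + of_nat m * L) + L)"
      by (intro eq_upto_add eq_upto_mult Suc L1 eq_upto_refl unital_mult unital_power unit)
    also have "g * (g ^ m * e + of_nat m * L) + L = g ^ Suc m * e + g * (of_nat m * L) + L"
      by (simp add: algebra_simps)
    also have "eq_upto (k + 3) \<dots> (g ^ Suc m * e + of_nat m * L + L)"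
      by (intro eq_upto_add Ln unit eq_upto_refl)
    finally show ?case
      by (simp add: algebra_simps)
  qed simp
  show "eq_upto (k + 3) (e' * g ^ m + of_nat m * L) (g ^ m * e')"
  proof (induction m)
    case (Suc m)
    \<comment> \<open>This uses \<open>g * e' = e' * g + e' * L\<close>. The bracket vanishes in the
      relevant degrees because \<open>e'\<close> and \<open>g ^ m\<close> have constant term
      1.\<close>
    have "e' * g ^ Suc m + of_nat (Suc m) * L
        = g * (e' * g ^ m) + of_nat m * L + (L - e' * L * g ^ m)"
      by (simp add: g L algebra_simps)
    also have "eq_upto (k + 3) \<dots> (g * (e' * g ^ m) + of_nat m * L + (L - L))"
      using unital_mult_unital[OF Lo, of e' "g ^ m"] unit
      by (intro eq_upto_add eq_upto_diff eq_upto_refl) (simp add: unital_power eval_nat_numeral)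
    also have "eq_upto (k + 3) \<dots> (g * (e' * g ^ m) + g * (of_nat m * L) + (L - L))"
      by (intro eq_upto_add eq_upto_refl eq_upto_sym[OF Ln] unit)
    also have "\<dots> = g * (e' * g ^ m + of_nat m * L)"
      by (simp add: algebra_simps)
    also have "eq_upto (k + 3) \<dots> (g * (g ^ m * e'))"
      by (intro eq_upto_mult eq_upto_refl Suc)
    finally show ?case
      by (simp add: mult.assoc)
  qed simp
qed


section \<open>Letter counts forced by agreement one degree further\<close>

text \<open>Both images become \<open>?f\<close> plus a multiple of \<open>L\<close>, with the half
  block to the right of all full blocks. Carrying it there in the second word costs one
  \<open>L\<close> per block. As counts are at most lengths, \<open>w\<close> then consists of
  \<open>c\<close> only and \<open>w'\<close> does not contain \<open>c\<close>.\<close>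

lemma count_shift:
  assumes "eq_upto (k + 3) (magnus (p @ (phi ^^ Suc k) w @ block k c @ s))
      (magnus ((p @ block k c) @ (phi ^^ Suc k) w' @ s))"
    and "length w = length w'"
  shows "count_list w c = length w + count_list w' c"
proof -
  let ?g = "magnus (block (Suc k) (\<not> c))" and ?L = "block_diff (Suc k) c" and ?e = "magnus (block k c)"
  let ?m = "length w" and ?n = "count_list w c" and ?n' = "count_list w' c"
  let ?f = "magnus p * ?g ^ ?m * ?e * magnus s"
  have "eq_upto (k + 3) (?f + of_nat ?n * ?L) (magnus (p @ (phi ^^ Suc k) w @ block k c @ s))"
    using eq_upto_sym[OF magnus_factorization[of "Suc k" p w "block k c @ s" c]]
    by (simp add: magnus_append mult.assoc eval_nat_numeral del: funpow.simps)
  also note assms(1)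
  also have "eq_upto (k + 3) (magnus ((p @ block k c) @ (phi ^^ Suc k) w' @ s))
      (magnus p * (?e * ?g ^ ?m) * magnus s + of_nat ?n' * ?L)"
    using magnus_factorization[of "Suc k" "p @ block k c" w' s c] assms(2)
    by (simp add: magnus_append mult.assoc eval_nat_numeral del: funpow.simps)
  also have "eq_upto (k + 3) \<dots> (magnus p * (?g ^ ?m * ?e + of_nat ?m * ?L) * magnus s + of_nat ?n' * ?L)"
    by (intro eq_upto_add eq_upto_mult eq_upto_refl magnus_half_block_commute)
  also have "\<dots> = ?f + magnus p * (of_nat ?m * ?L) * magnus s + of_nat ?n' * ?L"
    by (simp add: algebra_simps del: funpow.simps)
  also have "eq_upto (k + 3) \<dots> (?f + of_nat ?m * ?L + of_nat ?n' * ?L)"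
    using mult_unital_multiple[OF order_ge_block_diff[of "Suc k" c] unital_magnus unital_magnus]
    by (intro eq_upto_add eq_upto_refl) (simp add: eval_nat_numeral del: funpow.simps)
  also have "\<dots> = ?f + of_nat (?m + ?n') * ?L"
    by (simp add: algebra_simps del: funpow.simps)
  finally show ?thesis
    using block_diff_multiple_eq[of "Suc k" ?f ?n c "?m + ?n'"]
    by (simp add: eval_nat_numeral del: funpow.simps)
qed

text \<open>Both sides reduce to a power of \<open>?g\<close>. In the first word, carrying the half
  block of \<open>c\<close> to the right costs \<open>?m\<close> copies of \<open>L\<close>, and
  exchanging the two halves costs one more; in the second word, carrying the half block of
  \<open>\<not> c\<close> costs \<open>-?m\<close> copies.\<close>

lemma count_swap:
  assumes "eq_upto (k + 3) (magnus (block k c @ (phi ^^ Suc k) w @ block k (\<not> c)))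
      (magnus (block k (\<not> c) @ (phi ^^ Suc k) w' @ block k c))"
    and "length w = length w'"
  shows "count_list w' c = count_list w c + 2 * length w + 1"
proof -
  let ?g = "magnus (block (Suc k) (\<not> c))" and ?L = "block_diff (Suc k) c"
  let ?e = "magnus (block k c)" and ?e' = "magnus (block k (\<not> c))"
  let ?m = "length w" and ?n = "count_list w c" and ?n' = "count_list w' c"
  let ?f = "?g ^ Suc ?m"
  have g: "?g = ?e' * ?e" and L: "?L = ?e * ?e' - ?e' * ?e"
    by (simp_all add: block_diff_def block_Suc magnus_append del: funpow.simps)
  have Lo: "eq_upto (k + 3) (h * (of_nat m * ?L) * h') (of_nat m * ?L)"
    if "unital h" "unital h'" for h h' m
    using mult_unital_multiple[OF order_ge_block_diff[of "Suc k" c] that]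
    by (simp add: eval_nat_numeral del: funpow.simps)
  have "eq_upto (k + 3) (magnus (block k c @ (phi ^^ Suc k) w @ block k (\<not> c)))
      (?e * ?g ^ ?m * ?e' + of_nat ?n * ?L)"
    using magnus_factorization[of "Suc k" "block k c" w "block k (\<not> c)" c]
    by (simp add: eval_nat_numeral del: funpow.simps)
  also have "eq_upto (k + 3) \<dots> ((?g ^ ?m * ?e + of_nat ?m * ?L) * ?e' + of_nat ?n * ?L)"
    by (intro eq_upto_add eq_upto_mult eq_upto_refl magnus_half_block_commute)
  also have "\<dots> = ?f + ?g ^ ?m * (of_nat 1 * ?L) * 1 + 1 * (of_nat ?m * ?L) * ?e' + of_nat ?n * ?L"
    unfolding power_Suc2 by (simp add: g L algebra_simps del: funpow.simps)
  also have "eq_upto (k + 3) \<dots> (?f + of_nat 1 * ?L + of_nat ?m * ?L + of_nat ?n * ?L)"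
    by (intro eq_upto_add eq_upto_refl Lo unital_power unital_magnus unital_1)
  finally have u: "eq_upto (k + 3) (magnus (block k c @ (phi ^^ Suc k) w @ block k (\<not> c)))
      (?f + of_nat 1 * ?L + of_nat ?m * ?L + of_nat ?n * ?L)" .
  have "eq_upto (k + 3) (magnus (block k (\<not> c) @ (phi ^^ Suc k) w' @ block k c))
      (?e' * ?g ^ ?m * ?e + of_nat ?n' * ?L)"
    using magnus_factorization[of "Suc k" "block k (\<not> c)" w' "block k c" c] assms(2)
    by (simp add: eval_nat_numeral del: funpow.simps)
  \<comment> \<open>The added copies of \<open>L\<close> compensate the negative cost.\<close>
  then have "eq_upto (k + 3)
      (magnus (block k (\<not> c) @ (phi ^^ Suc k) w' @ block k c) + of_nat ?m * ?L)
      (?e' * ?g ^ ?m * ?e + of_nat ?n' * ?L + of_nat ?m * ?L)"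
    by (intro eq_upto_add eq_upto_refl)
  also have "eq_upto (k + 3) \<dots>
      (?e' * ?g ^ ?m * ?e + of_nat ?n' * ?L + 1 * (of_nat ?m * ?L) * ?e)"
    by (intro eq_upto_add eq_upto_refl eq_upto_sym[OF Lo] unital_magnus unital_1)
  also have "\<dots> = (?e' * ?g ^ ?m + of_nat ?m * ?L) * ?e + of_nat ?n' * ?L"
    by (simp add: algebra_simps del: funpow.simps)
  also have "eq_upto (k + 3) \<dots> (?g ^ ?m * ?e' * ?e + of_nat ?n' * ?L)"
    by (intro eq_upto_add eq_upto_mult eq_upto_refl magnus_half_block_commute)
  also have "\<dots> = ?f + of_nat ?n' * ?L"
    unfolding power_Suc2 by (simp add: g mult.assoc del: funpow.simps)
  finally have v: "eq_upto (k + 3)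
      (magnus (block k (\<not> c) @ (phi ^^ Suc k) w' @ block k c) + of_nat ?m * ?L)
      (?f + of_nat ?n' * ?L)" .
  have "eq_upto (k + 3) (?f + of_nat 1 * ?L + of_nat ?m * ?L + of_nat ?n * ?L + of_nat ?m * ?L)
      (?f + of_nat ?n' * ?L)"
    using eq_upto_trans[OF eq_upto_trans[OF eq_upto_add[OF eq_upto_sym[OF u] eq_upto_refl]
        eq_upto_add[OF assms(1) eq_upto_refl]] v] .
  then have "eq_upto (k + 3) (?f + of_nat (?n + ?m + ?m + 1) * ?L) (?f + of_nat ?n' * ?L)"
    by (simp add: algebra_simps del: funpow.simps)
  then show ?thesis
    using block_diff_multiple_eq[of "Suc k" ?f "?n + ?m + ?m + 1" c ?n']
    by (simp add: eval_nat_numeral del: funpow.simps)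
qed

text \<open>The two half blocks merge into an additional full block: carrying the first one across
  \<open>w\<close> costs one \<open>L\<close> per block, and exchanging the halves costs one more.
  As a consequence, \<open>w'\<close> consists of \<open>c\<close> only and \<open>w\<close> does
  not contain \<open>c\<close>.\<close>

lemma count_absorb:
  assumes "eq_upto (k + 3) (magnus ((p @ block k c) @ (phi ^^ Suc k) w @ block k (\<not> c) @ s))
      (magnus (p @ (phi ^^ Suc k) w' @ s))"
    and "length w' = Suc (length w)"
  shows "count_list w' c = count_list w c + length w'"
proof -
  let ?g = "magnus (block (Suc k) (\<not> c))" and ?L = "block_diff (Suc k) c"
  let ?e = "magnus (block k c)" and ?e' = "magnus (block k (\<not> c))"
  let ?m = "length w" and ?n = "count_list w c" and ?n' = "count_list w' c"
  let ?f = "magnus p * ?g ^ Suc ?m * magnus s"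
  have g: "?g = ?e' * ?e" and L: "?L = ?e * ?e' - ?e' * ?e"
    by (simp_all add: block_diff_def block_Suc magnus_append del: funpow.simps)
  have Lo: "eq_upto (k + 3) (h * (of_nat m * ?L) * h') (of_nat m * ?L)"
    if "unital h" "unital h'" for h h' m
    using mult_unital_multiple[OF order_ge_block_diff[of "Suc k" c] that]
    by (simp add: eval_nat_numeral del: funpow.simps)
  have "eq_upto (k + 3) (?f + of_nat ?n' * ?L) (magnus (p @ (phi ^^ Suc k) w' @ s))"
    using eq_upto_sym[OF magnus_factorization[of "Suc k" p w' s c]] assms(2)
    by (simp add: eval_nat_numeral del: funpow.simps)
  also note eq_upto_sym[OF assms(1)]
  also have "eq_upto (k + 3) (magnus ((p @ block k c) @ (phi ^^ Suc k) w @ block k (\<not> c) @ s))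
      (magnus p * (?e * ?g ^ ?m * ?e') * magnus s + of_nat ?n * ?L)"
    using magnus_factorization[of "Suc k" "p @ block k c" w "block k (\<not> c) @ s" c]
    by (simp add: magnus_append mult.assoc eval_nat_numeral del: funpow.simps)
  also have "eq_upto (k + 3) \<dots>
      (magnus p * ((?g ^ ?m * ?e + of_nat ?m * ?L) * ?e') * magnus s + of_nat ?n * ?L)"
    by (intro eq_upto_add eq_upto_mult eq_upto_refl magnus_half_block_commute)
  also have "\<dots> = ?f + (magnus p * ?g ^ ?m) * (of_nat 1 * ?L) * magnus s
      + magnus p * (of_nat ?m * ?L) * (?e' * magnus s) + of_nat ?n * ?L"
    unfolding power_Suc2 by (simp add: g L algebra_simps del: funpow.simps)
  also have "eq_upto (k + 3) \<dots> (?f + of_nat 1 * ?L + of_nat ?m * ?L + of_nat ?n * ?L)"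
    by (intro eq_upto_add eq_upto_refl Lo unital_mult unital_power unital_magnus)
  also have "\<dots> = ?f + of_nat (?n + ?m + 1) * ?L"
    by (simp add: algebra_simps del: funpow.simps)
  finally show ?thesis
    using block_diff_multiple_eq[of "Suc k" ?f ?n' c "?n + ?m + 1"] assms(2)
    by (simp add: eval_nat_numeral del: funpow.simps)
qed

lemma count_eq:
  assumes "eq_upto (k + 2) (magnus (p @ (phi ^^ k) w @ s)) (magnus (p @ (phi ^^ k) w' @ s))"
    and "length w = length w'"
  shows "count_list w c = count_list w' c"
proof -
  let ?f = "magnus p * magnus (block k (\<not> c)) ^ length w * magnus s"
  have "eq_upto (k + 2) (?f + of_nat (count_list w c) * block_diff k c)
      (?f + of_nat (count_list w' c) * block_diff k c)"
    using eq_upto_trans[OF eq_upto_trans[OF eq_upto_sym[OF magnus_factorization] assms(1)]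
        magnus_factorization, of c c] assms(2) by simp
  then show ?thesis
    using block_diff_multiple_eq[of k ?f _ c] by simp
qed

section \<open>Equivalent pairs give binomially equivalent words\<close>

text \<open>Under exchange of the two pairs, \<open>shift\<close> and \<open>absorb\<close> turn
  into \<open>unshift\<close> and \<open>unabsorb\<close>, and \<open>swap\<close> into itself with
  \<open>\<not> c\<close> for \<open>c\<close>.\<close>

lemma pair_equiv_elims:
  assumes "pair_equiv (Suc k) (p, s) (p', s')"
  obtains (eq) "p' = p" "s' = s"
  | (shift) c where "p' = p @ block k c" "s = block k c @ s'"
  | (unshift) c where "p = p' @ block k c" "s' = block k c @ s"
  | (swap) c where "p = block k c" "s = block k (\<not> c)" "p' = block k (\<not> c)" "s' = block k c"
  | (absorb) c where "p = p' @ block k c" "s = block k (\<not> c) @ s'"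
  | (unabsorb) c where "p' = p @ block k c" "s' = block k (\<not> c) @ s"
proof -
  note that = that
  have "\<exists>c. (p' = p \<and> s' = s) \<or> (p' = p @ block k c \<and> s = block k c @ s')
    \<or> (p = p' @ block k c \<and> s' = block k c @ s)
    \<or> (p = block k c \<and> s = block k (\<not> c) \<and> p' = block k (\<not> c) \<and> s' = block k c)
    \<or> (p = p' @ block k c \<and> s = block k (\<not> c) @ s')
    \<or> (p' = p @ block k c \<and> s' = block k (\<not> c) @ s)"
    using assms unfolding pair_equiv_def Let_def by (auto simp del: funpow.simps)
  then show ?thesis
    using that by (elim exE disjE conjE)
qed

text \<open>One degree below \<open>magnus_factorization\<close> the multiple of \<open>L\<close>
  disappears, so the letters of \<open>w\<close> no longer matter.\<close>

lemma magnus_factorization_coarse: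
  "eq_upto (Suc k) (magnus (p @ (phi ^^ k) w @ s))
     (magnus p * magnus (block k (\<not> c)) ^ length w * magnus s)"
proof -
  have "eq_upto (Suc k) (magnus (p @ (phi ^^ k) w @ s))
     (magnus p * magnus (block k (\<not> c)) ^ length w * magnus s
       + of_nat (count_list w c) * block_diff k c)"
    using magnus_factorization by (rule eq_upto_mono) simp
  also have "eq_upto (Suc k) \<dots> (magnus p * magnus (block k (\<not> c)) ^ length w * magnus s + 0)"
    by (intro eq_upto_add eq_upto_refl)
      (simp add: eq_upto_def order_ge_mult_left order_ge_block_diff)
  finally show ?thesis
    by simp
qed

text \<open>Modulo degree \<open>k + 2\<close> the cost \<open>L\<close> of the crossing vanishes.
  The two cases are whether the half block is the first or the second half of the full
  block.\<close>

lemma half_block_commute: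
  "eq_upto (k + 2) (magnus (block k c) * magnus (block (Suc k) d) ^ m)
     (magnus (block (Suc k) d) ^ m * magnus (block k c))"
proof -
  let ?L = "block_diff (Suc k)"
  have L: "eq_upto (k + 2) (f + of_nat m * ?L c) f" for f c
    using order_ge_block_diff[of "Suc k" c]
    by (simp add: eq_upto_def order_ge_mult_left del: funpow.simps)
  show ?thesis
  proof (cases "d = c")
    case True
    have "eq_upto (k + 2) (magnus (block k c) * magnus (block (Suc k) c) ^ m)
        (magnus (block k c) * magnus (block (Suc k) c) ^ m + of_nat m * ?L (\<not> c))"
      by (rule eq_upto_sym[OF L])
    also have "eq_upto (k + 2) \<dots> (magnus (block (Suc k) c) ^ m * magnus (block k c))"
      using eq_upto_mono[OF magnus_half_block_commute(2)[of k "\<not> c" m], of "k + 2"]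
      by (simp del: funpow.simps)
    finally show ?thesis
      using True by simp
  next
    case False
    then have d: "d = (\<not> c)"
      by auto
    have "eq_upto (k + 2) (magnus (block k c) * magnus (block (Suc k) d) ^ m)
        (magnus (block (Suc k) d) ^ m * magnus (block k c) + of_nat m * ?L c)"
      unfolding d using magnus_half_block_commute(1) by (rule eq_upto_mono) simp
    also note L
    finally show ?thesis .
  qed
qed

lemma pair_equiv_imp_binom_equiv:
  assumes "pair_equiv (Suc k) (p, s) (p', s')"
    and "length (p @ (phi ^^ Suc k) w @ s) = length (p' @ (phi ^^ Suc k) w' @ s')"
  shows "binom_equiv (Suc k) (p @ (phi ^^ Suc k) w @ s) (p' @ (phi ^^ Suc k) w' @ s')"
proof -
  \<comment> \<open>Carrying the half block across the full blocks settles \<open>shift\<close> and,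
    read backwards, \<open>unshift\<close>.\<close>
  have sh: "eq_upto (k + 2) (magnus (p @ (phi ^^ Suc k) w @ block k c @ s))
      (magnus ((p @ block k c) @ (phi ^^ Suc k) w' @ s))"
    if "length w' = length w" for p s c w w'
  proof -
    let ?g = "magnus (block (Suc k) (\<not> c))" and ?m = "length w"
    have "eq_upto (k + 2) (magnus (p @ (phi ^^ Suc k) w @ block k c @ s))
        (magnus p * (?g ^ ?m * magnus (block k c)) * magnus s)"
      using magnus_factorization_coarse[of "Suc k" p w "block k c @ s" c]
      by (simp add: magnus_append mult.assoc del: funpow.simps)
    also have "eq_upto (k + 2) \<dots> (magnus p * (magnus (block k c) * ?g ^ ?m) * magnus s)"
      by (intro eq_upto_mult eq_upto_refl eq_upto_sym[OF half_block_commute])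
    also have "eq_upto (k + 2) \<dots> (magnus ((p @ block k c) @ (phi ^^ Suc k) w' @ s))"
      using eq_upto_sym[OF magnus_factorization_coarse[of "Suc k" "p @ block k c" w' s c]] that
      by (simp add: magnus_append mult.assoc del: funpow.simps)
    finally show ?thesis .
  qed
  \<comment> \<open>The first half block is carried to the right until it meets its complement;
    together they form a full block of \<open>c\<close>, which is why the powers below are those of
    the block of \<open>c\<close>.\<close>
  have ab: "eq_upto (k + 2) (magnus ((p @ block k c) @ (phi ^^ Suc k) w @ block k (\<not> c) @ s))
      (magnus (p @ (phi ^^ Suc k) w' @ s))"
    if "length w' = Suc (length w)" for p s c w w'
  proof -
    let ?g = "magnus (block (Suc k) c)" and ?m = "length w"
    have "eq_upto (k + 2) (magnus ((p @ block k c) @ (phi ^^ Suc k) w @ block k (\<not> c) @ s))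
        (magnus p * (magnus (block k c) * ?g ^ ?m) * magnus (block k (\<not> c)) * magnus s)"
      using magnus_factorization_coarse[of "Suc k" "p @ block k c" w "block k (\<not> c) @ s" "\<not> c"]
      by (simp add: magnus_append mult.assoc del: funpow.simps)
    also have "eq_upto (k + 2) \<dots>
        (magnus p * (?g ^ ?m * magnus (block k c)) * magnus (block k (\<not> c)) * magnus s)"
      by (intro eq_upto_mult eq_upto_refl half_block_commute)
    also have "\<dots> = magnus p * ?g ^ Suc ?m * magnus s"
      unfolding power_Suc2 block_Suc[of k c] magnus_append by (simp only: mult.assoc)
    also have "eq_upto (k + 2) \<dots> (magnus (p @ (phi ^^ Suc k) w' @ s))"
      using eq_upto_sym[OF magnus_factorization_coarse[of "Suc k" p w' s "\<not> c"]] that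
      by (simp del: funpow.simps)
    finally show ?thesis .
  qed
  have len: "length p + 2 ^ Suc k * length w + length s
      = length p' + 2 ^ Suc k * length w' + length s'"
    using assms(2) by (simp del: funpow.simps power_Suc)
  have "eq_upto (k + 2) (magnus (p @ (phi ^^ Suc k) w @ s)) (magnus (p' @ (phi ^^ Suc k) w' @ s'))"
    using assms(1)
  proof (cases rule: pair_equiv_elims)
    case eq
    then have w: "length w' = length w"
      using len by simp
    show ?thesis
      using eq_upto_trans[OF magnus_factorization_coarse[of "Suc k" p w s True]
          eq_upto_sym[OF magnus_factorization_coarse[of "Suc k" p w' s True, unfolded w]]] eq
      by (simp del: funpow.simps)
  next
    case (shift c)
    with len have "length w' = length w"
      by simp
    with sh show ?thesis
      unfolding shift by blast
  next
    case (unshift c)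
    with len have "length w = length w'"
      by simp
    with sh show ?thesis
      unfolding unshift by (blast intro: eq_upto_sym)
  next
    case (swap c)
    have m: "length w' = length w"
      using len swap by simp
    \<comment> \<open>The half blocks at the two ends join to a full block, after which only the
      number of blocks matters. The base \<open>True\<close> does not depend on \<open>c\<close>, so
      both words reach the same power.\<close>
    have full: "eq_upto (k + 2) (magnus (block k c @ (phi ^^ Suc k) v @ block k (\<not> c)))
        (magnus (block (Suc k) True) ^ Suc (length v))" for c v
    proof -
      have "eq_upto (k + 2) (magnus (block k c @ (phi ^^ Suc k) v @ block k (\<not> c)))
          (magnus ((phi ^^ Suc k) v @ block k c @ block k (\<not> c)))"
        using eq_upto_sym[OF sh[of v v "[]" c "block k (\<not> c)"]] by (simp del: funpow.simps)
      also have "(phi ^^ Suc k) v @ block k c @ block k (\<not> c) = (phi ^^ Suc k) (v @ [c])"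
        unfolding phi_funpow_append block_Suc ..
      also have "eq_upto (k + 2) (magnus \<dots>) (magnus (block (Suc k) True) ^ Suc (length v))"
        using magnus_factorization_coarse[of "Suc k" "[]" "v @ [c]" "[]" False]
        by (simp del: funpow.simps power_Suc)
      finally show ?thesis .
    qed
    show ?thesis
      using eq_upto_trans[OF full[of c w] eq_upto_sym[OF full[of "\<not> c" w', unfolded m not_not]]]
      by (simp add: swap del: funpow.simps)
  next
    case (absorb c)
    with len have "2 ^ Suc k * length w' = 2 ^ Suc k * Suc (length w)"
      by simp
    then have "length w' = Suc (length w)"
      unfolding mult_cancel1 by simp
    with ab show ?thesis
      unfolding absorb by blast
  next
    case (unabsorb c)
    with len have "2 ^ Suc k * length w = 2 ^ Suc k * Suc (length w')"
      by simp
    then have "length w = Suc (length w')"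
      unfolding mult_cancel1 by simp
    with ab show ?thesis
      unfolding unabsorb by (blast intro: eq_upto_sym)
  qed
  then show ?thesis
    by (simp add: binom_equiv_iff del: funpow.simps)
qed


section \<open>Factors of the Thue--Morse word\<close>

lemma tm_Suc: "even i \<Longrightarrow> tm (Suc i) = (\<not> tm i)"
  using tm_double by (auto elim!: evenE)

text \<open>One of the positions \<open>i\<close> and \<open>i + 1\<close> is even, and the two
  letters from an even position on are distinct.\<close>

lemma tm_no_cube: "tm (Suc i) = tm i \<Longrightarrow> tm (Suc (Suc i)) \<noteq> tm i"
  using tm_Suc[of i] tm_Suc[of "Suc i"] by auto

lemma tm_factor_Cons: "i < j \<Longrightarrow> tm_factor i j = tm i # tm_factor (Suc i) j"
  by (simp add: tm_factor_def upt_conv_Cons)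

lemma set_tm_factor: "set (tm_factor i j) = tm ` {i..<j}"
  by (simp add: tm_factor_def)

lemma count_phi: "count_list (phi w) c = length w"
  by (induction w) auto

lemma count_tm_factor_even: "i \<le> j \<Longrightarrow> count_list (tm_factor (2 * i) (2 * j)) c = j - i"
  using phi_tm_factor[of i j] count_phi[of "tm_factor i j" c] by simp

lemma count_list_eq_length: "count_list w c = length w \<Longrightarrow> x \<in> set w \<Longrightarrow> x = c"
proof (induction w)
  case (Cons a w)
  then show ?case
    using count_le_length[of w c] by (auto split: if_splits)
qed simp

section \<open>Prefixes and suffixes of complementary blocks\<close>

lemma block_Not: "block k (\<not> c) = map Not (block k c)"
  using phi_funpow_map_Not[of k "[c]"] by simp

lemma length_block: "length (block k c) = 2 ^ k"
  by simp

lemma map_Not_eq: "map Not w = w \<longleftrightarrow> w = []"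
  by (cases w) auto

lemma block_eq_iff [simp]: "block k c = block k d \<longleftrightarrow> c = d"
proof
  assume eq: "block k c = block k d"
  show "c = d"
  proof (rule ccontr)
    assume "c \<noteq> d"
    then have "d = (\<not> c)"
      by auto
    then have "map Not (block k c) = block k c"
      using eq by (simp add: block_Not)
    then have "block k c = []"
      by (simp only: map_Not_eq)
    then show False
      using length_block[of k c] by (metis length_0_conv power_not_zero zero_neq_numeral)
  qed
qed simp

text \<open>The two blocks are complementary, so \<open>p\<close> and its complement are suffixes of
  equal length of the same block.\<close>

lemma suffix_block_both:
  assumes "suffix p (block k c)" "suffix p (block k (\<not> c))"
  shows "p = []"
proof -
  have "suffix (map Not p) (block k (\<not> c))"
    using assms(1) unfolding block_Not by (rule map_mono_suffix)
  then have "map Not p = p"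
    using assms(2) by (metis length_map suffix_length_suffix suffix_order.antisym order_refl)
  then show ?thesis
    by (simp add: map_Not_eq)
qed

lemma prefix_block_both:
  assumes "prefix p (block k c)" "prefix p (block k (\<not> c))"
  shows "p = []"
proof -
  have "prefix (map Not p) (block k (\<not> c))"
    using assms(1) unfolding block_Not by (rule map_mono_prefix)
  then have "map Not p = p"
    using assms(2) by (metis length_map prefix_length_prefix prefix_order.antisym order_refl)
  then show ?thesis
    by (simp add: map_Not_eq)
qed

text \<open>The second half of the larger block has the length of \<open>block k c\<close>. A border
  that contains a half block thus reveals the letter of the block it is cut from.\<close>

lemma suffix_append_block:
  assumes "suffix (p @ block k c) (block (Suc k) d)"
  shows "d = (\<not> c)" "suffix p (block k d)"
proof -
  obtain z where "z @ p @ block k c = block k d @ block k (\<not> d)"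
    using assms by (auto simp: suffix_def block_Suc simp del: funpow.simps)
  then have "z @ p = block k d \<and> block k c = block k (\<not> d)"
    using append_eq_append_conv[of "z @ p" "block k d" "block k c" "block k (\<not> d)"] by simp
  then show "d = (\<not> c)" "suffix p (block k d)"
    using suffixI[of "block k d" z p] by auto
qed

lemma prefix_block_append:
  assumes "prefix (block k c @ s) (block (Suc k) d)"
  shows "d = c" "prefix s (block k (\<not> d))"
proof -
  obtain z where "block k c @ s @ z = block k d @ block k (\<not> d)"
    using assms by (auto simp: prefix_def block_Suc simp del: funpow.simps)
  then have "block k c = block k d \<and> s @ z = block k (\<not> d)"
    using append_eq_append_conv[of "block k c" "block k d"] by simp
  then show "d = c" "prefix s (block k (\<not> d))"
    using prefixI[of "block k (\<not> d)" s z] by auto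
qed

text \<open>The factorization of order \<open>k\<close> of the factor at positions \<open>i, \<dots>, i + n - 1\<close> that is induced
  by this occurrence: its full blocks have the indices \<open>a, \<dots>, b - 1\<close>.\<close>

definition aligned :: "nat \<Rightarrow> nat \<Rightarrow> nat \<Rightarrow> nat \<Rightarrow> nat \<Rightarrow> bool" where
  "aligned k i n a b \<longleftrightarrow>
     i \<le> 2 ^ k * a \<and> 2 ^ k * a < i + 2 ^ k \<and> 2 ^ k * b \<le> i + n \<and> i + n < 2 ^ k * b + 2 ^ k"

lemma aligned_prefix:
  assumes "aligned k i n a b" "tm_factor i (2 ^ k * a) \<noteq> []"
  shows "1 \<le> a" "suffix (tm_factor i (2 ^ k * a)) (block k (tm (a - 1)))"
proof -
  have a: "i < 2 ^ k * a"
    using assms(2) by (simp add: tm_factor_def)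
  then obtain a' where a': "a = Suc a'"
    by (cases a) auto
  have "2 ^ k * a' \<le> i"
    using assms(1) by (simp add: aligned_def a')
  then have "tm_factor (2 ^ k * a') (2 ^ k * a) = tm_factor (2 ^ k * a') i @ tm_factor i (2 ^ k * a)"
    using a by (intro tm_factor_append) auto
  then have "block k (tm a') = tm_factor (2 ^ k * a') i @ tm_factor i (2 ^ k * a)"
    using tm_factor_block[of k a'] by (simp only: a')
  then show "1 \<le> a" "suffix (tm_factor i (2 ^ k * a)) (block k (tm (a - 1)))"
    using suffixI a' by auto
qed

lemma aligned_suffix:
  assumes "aligned k i n a b"
  shows "prefix (tm_factor (2 ^ k * b) (i + n)) (block k (tm b))"
proof -
  have "tm_factor (2 ^ k * b) (2 ^ k * Suc b)
      = tm_factor (2 ^ k * b) (i + n) @ tm_factor (i + n) (2 ^ k * Suc b)"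
    using assms by (intro tm_factor_append) (auto simp: aligned_def)
  then show ?thesis
    unfolding tm_factor_block by (rule prefixI)
qed

lemma aligned_decomposition:
  assumes "aligned k i n a b" "a \<le> b"
  shows "tm_factor i (i + n)
     = tm_factor i (2 ^ k * a) @ (phi ^^ k) (tm_factor a b) @ tm_factor (2 ^ k * b) (i + n)"
proof -
  have "2 ^ k * a \<le> 2 ^ k * b"
    using assms(2) by simp
  moreover have "2 ^ k * b \<le> i + n" "i \<le> 2 ^ k * a"
    using assms(1) by (simp_all add: aligned_def)
  moreover from calculation have "2 ^ k * a \<le> i + n"
    by linarith
  ultimately show ?thesis
    using tm_factor_append[of i "2 ^ k * a" "i + n"]
      tm_factor_append[of "2 ^ k * a" "2 ^ k * b" "i + n"] phi_funpow_tm_factor[of a b k] assms(2)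
    by simp
qed

lemma aligned_length:
  assumes "aligned k i n a b" "a \<le> b"
  shows "n = length (tm_factor i (2 ^ k * a)) + 2 ^ k * (b - a)
     + length (tm_factor (2 ^ k * b) (i + n))"
  using arg_cong[OF aligned_decomposition[OF assms], of length] by simp

lemma aligned_length_less:
  assumes "aligned k i n a b"
  shows "length (tm_factor i (2 ^ k * a)) < 2 ^ k"
    and "length (tm_factor (2 ^ k * b) (i + n)) < 2 ^ k"
  using assms by (auto simp: aligned_def)

text \<open>The occurrence stays and the grid is refined: a border of length at least
  \<open>2 ^ k\<close> gives up its inner half block, which becomes the first or last full block of
  order \<open>k\<close>. The parities of \<open>a\<close> and \<open>b\<close> record whether this
  happens.\<close>

lemma aligned_refine:
  assumes "aligned (Suc k) i n A B" "2 ^ Suc k - 1 \<le> n"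
  obtains a b where "aligned k i n a b" "a < b"
    and "a = 2 * A \<and> tm_factor i (2 ^ Suc k * A) = tm_factor i (2 ^ k * a) \<or>
      Suc a = 2 * A \<and> tm_factor i (2 ^ Suc k * A) = tm_factor i (2 ^ k * a) @ block k (tm a)"
    and "b = 2 * B \<and> tm_factor (2 ^ Suc k * B) (i + n) = tm_factor (2 ^ k * b) (i + n) \<or>
      b = Suc (2 * B) \<and>
      tm_factor (2 ^ Suc k * B) (i + n) = block k (tm (2 * B)) @ tm_factor (2 ^ k * b) (i + n)"
proof -
  define N :: nat where "N = 2 ^ k"
  have N: "N > 0" "2 ^ Suc k = 2 * N"
    by (simp_all add: N_def)
  have al: "i \<le> 2 * N * A" "2 * N * A < i + 2 * N" "2 * N * B \<le> i + n" "i + n < 2 * N * B + 2 * N"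
    using assms(1) unfolding aligned_def N(2) by auto
  obtain a where a: "i \<le> N * a" "N * a < i + N"
    "a = 2 * A \<and> tm_factor i (2 * N * A) = tm_factor i (N * a) \<or>
      Suc a = 2 * A \<and> tm_factor i (2 * N * A) = tm_factor i (N * a) @ block k (tm a)"
  proof (cases "2 * N * A < i + N")
    case True
    then show thesis
      using al that[of "2 * A"] by (simp add: mult.assoc mult.left_commute)
  next
    case False
    then have "A \<noteq> 0"
      using N(1) by (intro notI) simp
    then obtain A' where A': "A = Suc A'"
      by (cases A) auto
    define a where "a = Suc (2 * A')"
    have Na: "N * a + N = 2 * N * A"
      by (simp add: a_def A')
    have "tm_factor i (2 * N * A) = tm_factor i (N * a) @ tm_factor (N * a) (2 * N * A)"
      by (intro tm_factor_append) (use False Na in linarith)+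
    also have "tm_factor (N * a) (2 * N * A) = tm_factor (N * a) (N * Suc a)"
      using Na by (simp add: add.commute)
    also have "tm_factor (N * a) (N * Suc a) = block k (tm a)"
      unfolding N_def by (rule tm_factor_block)
    finally have "tm_factor i (2 * N * A) = tm_factor i (N * a) @ block k (tm a)" .
    moreover have "i \<le> N * a" "N * a < i + N" "Suc a = 2 * A"
      using al False Na by (auto simp: a_def A')
    ultimately show thesis
      using that by blast
  qed
  obtain b where b: "N * b \<le> i + n" "i + n < N * b + N"
    "b = 2 * B \<and> tm_factor (2 * N * B) (i + n) = tm_factor (N * b) (i + n) \<or>
      b = Suc (2 * B) \<and>
      tm_factor (2 * N * B) (i + n) = block k (tm (2 * B)) @ tm_factor (N * b) (i + n)"
  proof (cases "i + n < 2 * N * B + N")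
    case True
    then show thesis
      using al that[of "2 * B"] by (simp add: mult.assoc mult.left_commute)
  next
    case False
    define b where "b = Suc (2 * B)"
    have Nb: "N * b = 2 * N * B + N"
      by (simp add: b_def)
    have "tm_factor (2 * N * B) (i + n) = tm_factor (2 * N * B) (N * b) @ tm_factor (N * b) (i + n)"
      using False Nb by (intro tm_factor_append) auto
    also have "tm_factor (2 * N * B) (N * b) = block k (tm (2 * B))"
      using tm_factor_block[of k "2 * B"] by (simp add: N_def b_def algebra_simps)
    finally show thesis
      using that[of b] al False Nb by (simp add: b_def)
  qed
  \<comment> \<open>\<open>N * a \<le> i + N - 1 \<le> i + n - N < N * b\<close>, where the middle
    step is the lower bound on \<open>n\<close>.\<close>
  have "N * a < N * b"
    using a b assms(2) N by linarith
  then have "a < b"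
    by simp
  then show thesis
    using that[of a b] a b unfolding aligned_def N_def[symmetric] N(2) by auto
qed

section \<open>Refining a pair by one order\<close>

lemma pair_equiv_refl: "length p < 2 ^ k \<Longrightarrow> length s < 2 ^ k \<Longrightarrow> pair_equiv k (p, s) (p, s)"
  by (simp add: pair_equiv_def Let_def)

text \<open>Positions \<open>2 * x\<close> and \<open>2 * x + 1\<close> carry complementary letters,
  so the count of \<open>True\<close> sees only the unpaired letters at the two ends. These are the
  letters of the half blocks that the borders of order \<open>Suc k\<close> take over.\<close>

lemma pair_equiv_SucI:
  assumes "a = 2 * A \<and> P = p \<or> Suc a = 2 * A \<and> P = p @ block k (tm a)"
    and "b = 2 * B \<and> S = s \<or> b = Suc (2 * B) \<and> S = block k (tm (2 * B)) @ s"
    and "a' = 2 * A' \<and> P' = p \<or> Suc a' = 2 * A' \<and> P' = p @ block k (tm a')"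
    and "b' = 2 * B' \<and> S' = s \<or> b' = Suc (2 * B') \<and> S' = block k (tm (2 * B')) @ s"
    and "a < b" "a' < b'" "b - a = b' - a'"
    and count: "count_list (tm_factor a b) True = count_list (tm_factor a' b') True"
    and "length P < 2 ^ Suc k" "length S < 2 ^ Suc k" "length P' < 2 ^ Suc k" "length S' < 2 ^ Suc k"
    and p: "p \<noteq> [] \<Longrightarrow> suffix p (block k (tm (a - 1)))"
      "p \<noteq> [] \<Longrightarrow> suffix p (block k (tm (a' - 1)))"
    and s: "prefix s (block k (tm b))" "prefix s (block k (tm b'))"
  shows "pair_equiv (Suc k) (P, S) (P', S')"
proof -
  have count_ab: "count_list (tm_factor a b) True
      = B - A + (if odd a \<and> tm a then 1 else 0) + (if odd b \<and> tm (2 * B) then 1 else 0) \<and> A \<le> B"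
    if "a = 2 * A \<or> Suc a = 2 * A" "b = 2 * B \<or> b = Suc (2 * B)" "a < b" for a b A B
  proof -
    have AB: "A \<le> B"
      using that by auto
    have 1: "tm_factor a b = (if odd a then [tm a] else []) @ tm_factor (2 * A) b"
      using that(1)
    proof
      assume "Suc a = 2 * A"
      then show ?thesis
        using tm_factor_Cons[OF that(3)] by (auto, presburger)
    qed simp
    have 2: "tm_factor (2 * A) b = tm_factor (2 * A) (2 * B) @ (if odd b then [tm (2 * B)] else [])"
      using that(2)
    proof
      assume "b = Suc (2 * B)"
      then show ?thesis
        using AB by (simp add: tm_factor_def)
    qed simp
    show ?thesis
      unfolding 1 2 using AB by (simp add: count_tm_factor_even)
  qed
  have bb: "b = 2 * B \<or> b = Suc (2 * B)" "b' = 2 * B' \<or> b' = Suc (2 * B')"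
    using assms(2,4) by blast+
  have ab: "b + a' = b' + a"
    using assms(5-7) by linarith
  have c1: "A \<le> B \<and> count_list (tm_factor a b) True = B - A
      + (if odd a \<and> tm a then 1 else 0) + (if odd b \<and> tm (2 * B) then 1 else 0)"
    and c2: "A' \<le> B' \<and> count_list (tm_factor a' b') True = B' - A'
      + (if odd a' \<and> tm a' then 1 else 0) + (if odd b' \<and> tm (2 * B') then 1 else 0)"
    using count_ab[of a A b B] count_ab[of a' A' b' B'] assms(1-6) by blast+
  have eqI: ?thesis if "P' = P" "S' = S"
    using that assms(9-12) by (simp add: pair_equiv_refl del: funpow.simps power_Suc)
  have intros: "P' = P @ block k c \<Longrightarrow> S = block k c @ S' \<Longrightarrow> ?thesis"
    "P = P' @ block k c \<Longrightarrow> S' = block k c @ S \<Longrightarrow> ?thesis"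
    "P = block k c \<Longrightarrow> S = block k (\<not> c) \<Longrightarrow> P' = block k (\<not> c) \<Longrightarrow> S' = block k c \<Longrightarrow> ?thesis"
    "P = P' @ block k c \<Longrightarrow> S = block k (\<not> c) @ S' \<Longrightarrow> ?thesis"
    "P' = P @ block k c \<Longrightarrow> S' = block k (\<not> c) @ S \<Longrightarrow> ?thesis" for c
    using assms(9-12) unfolding pair_equiv_def Let_def prod.case diff_Suc_1
    by (auto simp del: funpow.simps intro!: exI[of _ c])
  \<comment> \<open>The parity of \<open>a\<close> tells whether the left border takes over a half
    block. Once the parities of \<open>a\<close> and \<open>a'\<close> are fixed, equal lengths tie
    those of \<open>b\<close> and \<open>b'\<close>.\<close>
  consider (ee) "a = 2 * A" "P = p" "a' = 2 * A'" "P' = p"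
    | (eo) "a = 2 * A" "P = p" "Suc a' = 2 * A'" "P' = p @ block k (tm a')"
    | (oe) "Suc a = 2 * A" "P = p @ block k (tm a)" "a' = 2 * A'" "P' = p"
    | (oo) "Suc a = 2 * A" "P = p @ block k (tm a)" "Suc a' = 2 * A'" "P' = p @ block k (tm a')"
    using assms(1,3) by blast
  then show ?thesis
  proof cases
    case ee
    have par: "b = 2 * B \<longleftrightarrow> b' = 2 * B'"
      using ee(1,3) bb ab by presburger
    show ?thesis
    proof (cases "b = 2 * B")
      case True
      then show ?thesis
        using eqI ee assms(2,4) par by auto
    next
      case False
      then have b: "b = Suc (2 * B)" "S = block k (tm (2 * B)) @ s"
        "b' = Suc (2 * B')" "S' = block k (tm (2 * B')) @ s"
        using assms(2,4) par by auto
      have "B - A = B' - A'"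
        using ee b c1 c2 ab by linarith
      then have "tm (2 * B) = tm (2 * B')"
        using c1 c2 count ee b by (simp split: if_splits)
      then show ?thesis
        using eqI ee b by simp
    qed
  next
    case eo
    have par: "b = 2 * B \<longleftrightarrow> b' = Suc (2 * B')"
      using eo(1,3) bb ab by presburger
    show ?thesis
    proof (cases "b = 2 * B")
      case True
      then have b: "S = s" "b' = Suc (2 * B')" "S' = block k (tm (2 * B')) @ s"
        using assms(2,4) par by auto
      have "odd a'"
        using eo by presburger
      have "B - A = Suc (B' - A')"
        using eo b True c1 c2 ab by linarith
      then have "tm (2 * B') = (\<not> tm a')"
        using c1 c2 count eo b True \<open>odd a'\<close> by (simp split: if_splits)
      then show ?thesis
        using intros(5)[of "tm a'"] eo b by simp
    next
      case False
      then have b: "b = Suc (2 * B)" "S = block k (tm (2 * B)) @ s" "b' = 2 * B'" "S' = s"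
        using assms(2,4) par by auto
      have "odd a'"
        using eo by presburger
      have "B - A = B' - A'"
        using eo b c1 c2 ab by linarith
      then have "tm (2 * B) = tm a'"
        using c1 c2 count eo b \<open>odd a'\<close> by (simp split: if_splits)
      then show ?thesis
        using intros(1)[of "tm a'"] eo b by simp
    qed
  next
    case oe
    have par: "b' = 2 * B' \<longleftrightarrow> b = Suc (2 * B)"
      using oe(1,3) bb ab by presburger
    show ?thesis
    proof (cases "b' = 2 * B'")
      case True
      then have b: "S' = s" "b = Suc (2 * B)" "S = block k (tm (2 * B)) @ s"
        using assms(2,4) par by auto
      have "odd a"
        using oe by presburger
      have "B' - A' = Suc (B - A)"
        using oe b True c1 c2 ab by linarith
      then have "tm (2 * B) = (\<not> tm a)"
        using c1 c2 count oe b True \<open>odd a\<close> by (simp split: if_splits)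
      then show ?thesis
        using intros(4)[of "tm a"] oe b by simp
    next
      case False
      then have b: "b' = Suc (2 * B')" "S' = block k (tm (2 * B')) @ s" "b = 2 * B" "S = s"
        using assms(2,4) par by auto
      have "odd a"
        using oe by presburger
      have "B - A = B' - A'"
        using oe b c1 c2 ab by linarith
      then have "tm (2 * B') = tm a"
        using c1 c2 count oe b \<open>odd a\<close> by (simp split: if_splits)
      then show ?thesis
        using intros(2)[of "tm a"] oe b by simp
    qed
  next
    case oo
    have odd: "odd a" "odd a'"
      using oo by presburger+
    have par: "b = 2 * B \<longleftrightarrow> b' = 2 * B'"
      using oo(1,3) bb ab by presburger
    show ?thesis
    proof (cases "b = 2 * B")
      case True
      then have b: "b' = 2 * B'" "S = s" "S' = s"
        using assms(2,4) par by auto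
      have "B - A = B' - A'"
        using oo b True c1 c2 ab by linarith
      then have "tm a = tm a'"
        using c1 c2 count b True odd by (simp split: if_splits)
      then show ?thesis
        using eqI oo b by simp
    next
      case False
      then have b: "b = Suc (2 * B)" "S = block k (tm (2 * B)) @ s"
        "b' = Suc (2 * B')" "S' = block k (tm (2 * B')) @ s"
        using assms(2,4) par by auto
      have "B - A = B' - A'"
        using oo b c1 c2 ab by linarith
      \<comment> \<open>With unpaired letters at both ends only their sum is determined, so the
        letters agree or are crossed.\<close>
      then have eq: "of_bool (tm a) + of_bool (tm (2 * B)) = (of_bool (tm a') + of_bool (tm (2 * B')) :: nat)"
        using c1 c2 count b odd
        by (cases "tm a"; cases "tm (2 * B)"; cases "tm a'"; cases "tm (2 * B')") simp_all
      show ?thesis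
      proof (cases "tm a = tm a'")
        case True
        then have "tm (2 * B) = tm (2 * B')"
          using eq by (simp add: of_bool_eq_iff)
        then show ?thesis
          using eqI oo b True by simp
      next
        case False
        then have x: "tm a' = (\<not> tm a)" "tm (2 * B) = (\<not> tm a)" "tm (2 * B') = tm a"
          using eq by (auto simp: of_bool_def split: if_splits)
        \<comment> \<open>In the crossed case the letters before \<open>a\<close> and
          \<open>a'\<close> are complementary, so \<open>p\<close> is a suffix of both blocks;
          likewise \<open>s\<close> is a prefix of both. Both are therefore empty, as
          \<open>swap\<close> requires.\<close>
        have "tm a = (\<not> tm (a - 1))" "tm a' = (\<not> tm (a' - 1))"
          using tm_Suc[of "a - 1"] tm_Suc[of "a' - 1"] odd by (auto elim!: oddE)
        then have "p = []"
          using suffix_block_both[of p k "tm (a - 1)"] p x by auto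
        moreover have "tm b = tm a" "tm b' = (\<not> tm a)"
          using tm_Suc[of "2 * B"] tm_Suc[of "2 * B'"] b x by auto
        then have "s = []"
          using prefix_block_both[of s k "tm a"] s by simp
        ultimately show ?thesis
          using intros(3)[of "tm a"] oo b x by simp
      qed
    qed
  qed
qed


section \<open>Binomially equivalent factors have equivalent pairs\<close>

text \<open>By \<open>count_shift\<close> all full blocks of the first word belong to
  \<open>c\<close> and all those of the second to \<open>\<not> c\<close>. The right border of the
  first word continues its run, so there is only one full block; parity then makes \<open>p0\<close>
  and \<open>s0\<close> empty. This leaves \<open>n = 3 * 2 ^ k\<close>, which meets the first bound
  on \<open>n\<close> only for \<open>n = 3\<close>, and the second excludes that.\<close>

lemma shift_impossible:
  assumes al: "aligned (Suc k) i n a b" "aligned (Suc k) j n a' b'" and less: "a < b" "a' < b'"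
    and n: "2 ^ (k + 2) - 1 \<le> n" "4 \<le> n"
    and p: "tm_factor j (2 ^ Suc k * a') = tm_factor i (2 ^ Suc k * a) @ block k c"
    and s: "tm_factor (2 ^ Suc k * b) (i + n) = block k c @ tm_factor (2 ^ Suc k * b') (j + n)"
    and eq: "eq_upto (k + 3) (magnus (tm_factor i (i + n))) (magnus (tm_factor j (j + n)))"
  shows False
proof -
  define p0 where "p0 = tm_factor i (2 ^ Suc k * a)"
  define s0 where "s0 = tm_factor (2 ^ Suc k * b') (j + n)"
  have len: "n = length p0 + 2 ^ Suc k * (b - a) + 2 ^ k + length s0"
    using aligned_length[OF al(1)] less unfolding p0_def s0_def s by simp
  have "2 ^ Suc k * (b - a) = 2 ^ Suc k * (b' - a')"
    using aligned_length[OF al(2)] len less unfolding p p0_def[symmetric] s0_def[symmetric] by simp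
  then have m: "b - a = b' - a'"
    unfolding mult_cancel1 by simp
  have u: "tm_factor i (i + n) = p0 @ (phi ^^ Suc k) (tm_factor a b) @ block k c @ s0"
    using aligned_decomposition[OF al(1)] less by (simp only: p0_def s0_def s less_imp_le)
  have v: "tm_factor j (j + n) = (p0 @ block k c) @ (phi ^^ Suc k) (tm_factor a' b') @ s0"
    using aligned_decomposition[OF al(2)] less by (simp only: p0_def s0_def p less_imp_le)
  have "count_list (tm_factor a b) c = length (tm_factor a b) + count_list (tm_factor a' b') c"
    using eq unfolding u v by (rule count_shift) (simp add: m)
  then have cnt: "count_list (tm_factor a b) c = length (tm_factor a b)" "c \<notin> set (tm_factor a' b')"
    using count_le_length[of "tm_factor a b" c] by (simp_all flip: count_list_0_iff)
  have c: "tm x = c" if "a \<le> x" "x < b" for x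
    using count_list_eq_length[OF cnt(1), of "tm x"] that by (simp add: set_tm_factor)
  have c': "tm x = (\<not> c)" if "a' \<le> x" "x < b'" for x
    using cnt(2) that by (auto simp: set_tm_factor)
  have "prefix (block k c @ s0) (block (Suc k) (tm b))"
    using aligned_suffix[OF al(1)] by (simp only: s s0_def)
  note s1 = prefix_block_append[OF this]
  have "p0 @ block k c \<noteq> []"
    using length_block[of k c] by (metis append_is_Nil_conv length_0_conv power_not_zero zero_neq_numeral)
  then have "1 \<le> a'" "suffix (p0 @ block k c) (block (Suc k) (tm (a' - 1)))"
    using aligned_prefix[OF al(2)] unfolding p p0_def[symmetric] by simp_all
  note p1 = this(1) suffix_append_block[OF this(2)]
  have ba: "b = Suc a"
  proof (rule ccontr)
    assume "b \<noteq> Suc a"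
    then have "tm (b - 2) = c" "tm (b - 1) = c" "Suc (b - 2) = b - 1" "Suc (b - 1) = b"
      using c less by auto
    then show False
      using tm_no_cube[of "b - 2"] s1(1) by simp
  qed
  then have b'a': "b' = Suc a'"
    using m less by simp
  have ta: "tm a = c" "tm b = c" "tm a' = (\<not> c)" "tm (a' - 1) = (\<not> c)"
    using c[of a] c'[of a'] less s1(1) p1(2) by simp_all
  have "odd a"
    using tm_Suc[of a] ta ba by auto
  then have "1 \<le> a" "tm (a - 1) = (\<not> c)"
    using tm_Suc[of "a - 1"] ta by (auto elim!: oddE)
  \<comment> \<open>The letter before \<open>a\<close> makes \<open>p0\<close> a suffix of the block
    of \<open>\<not> c\<close> of order \<open>Suc k\<close>, whose second half is the block of
    \<open>c\<close>. By \<open>p1\<close>, \<open>p0\<close> is also a suffix of the block of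
    \<open>\<not> c\<close> of order \<open>k\<close>.\<close>
  have "p0 = []"
  proof (rule ccontr)
    assume "p0 \<noteq> []"
    then have "suffix p0 (block (Suc k) (\<not> c))"
      using aligned_prefix[OF al(1)] \<open>tm (a - 1) = (\<not> c)\<close> unfolding p0_def by simp
    moreover have "suffix (block k c) (block (Suc k) (\<not> c))"
      unfolding block_Suc by (simp add: suffix_def)
    moreover have "length p0 \<le> length (block k c)"
      using suffix_length_le[OF p1(3)] by simp
    ultimately have "suffix p0 (block k c)"
      by (rule suffix_length_suffix)
    then show False
      using suffix_block_both[of p0 k c] p1(2,3) \<open>p0 \<noteq> []\<close> by simp
  qed
  \<comment> \<open>Two equal letters end at \<open>a'\<close>, so they straddle a pair; this fixes
    the letter after \<open>a'\<close>, and the mirrored argument applies to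
    \<open>s0\<close>.\<close>
  have "even a'"
    using tm_Suc[of "a' - 1"] ta p1(1) by (auto elim!: oddE)
  then have "tm b' = c"
    using tm_Suc[of a'] ta b'a' by simp
  have "s0 = []"
  proof -
    have "prefix s0 (block (Suc k) c)"
      using aligned_suffix[OF al(2)] \<open>tm b' = c\<close> unfolding s0_def by simp
    moreover have "prefix (block k c) (block (Suc k) c)"
      unfolding block_Suc by simp
    moreover have "length s0 \<le> length (block k c)"
      using prefix_length_le[OF s1(2)] by simp
    ultimately have "prefix s0 (block k c)"
      by (rule prefix_length_prefix)
    then show ?thesis
      using prefix_block_both[of s0 k c] s1 by simp
  qed
  then have "n = 3 * 2 ^ k"
    using len \<open>p0 = []\<close> ba by simp
  then have "(2::nat) ^ k \<le> 1"
    using n(1) by (simp add: power_add)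
  then show False
    using n(2) \<open>n = 3 * 2 ^ k\<close> by simp
qed

text \<open>The count obtained from \<open>count_swap\<close> exceeds the number of blocks.\<close>

lemma swap_impossible:
  assumes al: "aligned (Suc k) i n a b" "aligned (Suc k) j n a' b'" and less: "a < b" "a' < b'"
    and p: "tm_factor i (2 ^ Suc k * a) = block k c" "tm_factor j (2 ^ Suc k * a') = block k (\<not> c)"
    and s: "tm_factor (2 ^ Suc k * b) (i + n) = block k (\<not> c)"
      "tm_factor (2 ^ Suc k * b') (j + n) = block k c"
    and eq: "eq_upto (k + 3) (magnus (tm_factor i (i + n))) (magnus (tm_factor j (j + n)))"
  shows False
proof -
  have "2 ^ Suc k * (b - a) = 2 ^ Suc k * (b' - a')"
    using aligned_length[OF al(1)] aligned_length[OF al(2)] less unfolding p s by simp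
  then have m: "b - a = b' - a'"
    unfolding mult_cancel1 by simp
  have u: "tm_factor i (i + n) = block k c @ (phi ^^ Suc k) (tm_factor a b) @ block k (\<not> c)"
    using aligned_decomposition[OF al(1)] less by (simp only: p s less_imp_le)
  have v: "tm_factor j (j + n) = block k (\<not> c) @ (phi ^^ Suc k) (tm_factor a' b') @ block k c"
    using aligned_decomposition[OF al(2)] less by (simp only: p s less_imp_le)
  have "count_list (tm_factor a' b') c
      = count_list (tm_factor a b) c + 2 * length (tm_factor a b) + 1"
    using eq unfolding u v by (rule count_swap) (simp add: m)
  then show False
    using count_le_length[of "tm_factor a' b'" c] m by simp
qed

text \<open>By \<open>count_absorb\<close> no full block of the first word belongs to
  \<open>c\<close>. The half blocks in its borders force \<open>\<not> c\<close> at
  \<open>a - 1\<close> and at \<open>b\<close> as well, so \<open>a - 1\<close>, \<open>a\<close>,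
  \<open>a + 1\<close> would carry three equal letters.\<close>

lemma absorb_impossible:
  assumes al: "aligned (Suc k) i n a b" "aligned (Suc k) j n a' b'" and less: "a < b" "a' < b'"
    and p: "tm_factor i (2 ^ Suc k * a) = tm_factor j (2 ^ Suc k * a') @ block k c"
    and s: "tm_factor (2 ^ Suc k * b) (i + n)
      = block k (\<not> c) @ tm_factor (2 ^ Suc k * b') (j + n)"
    and eq: "eq_upto (k + 3) (magnus (tm_factor i (i + n))) (magnus (tm_factor j (j + n)))"
  shows False
proof -
  define p0 where "p0 = tm_factor j (2 ^ Suc k * a')"
  define s0 where "s0 = tm_factor (2 ^ Suc k * b') (j + n)"
  have "2 ^ Suc k * Suc (b - a) = 2 ^ Suc k * (b' - a')"
    using aligned_length[OF al(1)] aligned_length[OF al(2)] less unfolding p s by simp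
  then have m: "Suc (b - a) = b' - a'"
    unfolding mult_cancel1 by simp
  have u: "tm_factor i (i + n)
      = (p0 @ block k c) @ (phi ^^ Suc k) (tm_factor a b) @ block k (\<not> c) @ s0"
    using aligned_decomposition[OF al(1)] less by (simp only: p0_def s0_def p s less_imp_le)
  have v: "tm_factor j (j + n) = p0 @ (phi ^^ Suc k) (tm_factor a' b') @ s0"
    using aligned_decomposition[OF al(2)] less by (simp only: p0_def s0_def less_imp_le)
  have "count_list (tm_factor a' b') c = count_list (tm_factor a b) c + length (tm_factor a' b')"
    using eq unfolding u v by (rule count_absorb) (simp add: m)
  then have "c \<notin> set (tm_factor a b)"
    using count_le_length[of "tm_factor a' b'" c] by (simp flip: count_list_0_iff)
  then have c: "tm x = (\<not> c)" if "a \<le> x" "x < b" for x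
    using that by (auto simp: set_tm_factor)
  have "prefix (block k (\<not> c) @ s0) (block (Suc k) (tm b))"
    using aligned_suffix[OF al(1)] by (simp only: s s0_def)
  then have b: "tm b = (\<not> c)"
    by (rule prefix_block_append)
  have "p0 @ block k c \<noteq> []"
    using length_block[of k c] by (metis append_is_Nil_conv length_0_conv power_not_zero zero_neq_numeral)
  then have a: "1 \<le> a" and "suffix (p0 @ block k c) (block (Suc k) (tm (a - 1)))"
    using aligned_prefix[OF al(1)] unfolding p p0_def[symmetric] by simp_all
  then have "tm (a - 1) = (\<not> c)"
    using suffix_append_block(1) by blast
  moreover have "tm a = (\<not> c)" "tm (Suc a) = (\<not> c)"
    using c[of a] c[of "Suc a"] b less by (simp, cases "b = Suc a") simp_all
  ultimately show False
    using tm_no_cube[of "a - 1"] a by simp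
qed

text \<open>The pairs are those of arbitrary occurrences. The bound \<open>4 \<le> n\<close> excludes only the words 010
  and 101 at order 2, each of which has two occurrences with inequivalent pairs.\<close>

lemma binom_equiv_imp_pair_equiv:
  assumes "aligned k i n a b" "aligned k j n a' b'" "2 ^ k - 1 \<le> n" "4 \<le> n"
    and "binom_equiv k (tm_factor i (i + n)) (tm_factor j (j + n))"
  shows "pair_equiv k (tm_factor i (2 ^ k * a), tm_factor (2 ^ k * b) (i + n))
    (tm_factor j (2 ^ k * a'), tm_factor (2 ^ k * b') (j + n))"
  using assms
proof (induction k arbitrary: a b a' b')
  case 0
  then show ?case
    by (simp add: aligned_def pair_equiv_refl tm_factor_def)
next
  case (Suc k A B A' B')
  obtain a b where ab: "aligned k i n a b" "a < b"
    "a = 2 * A \<and> tm_factor i (2 ^ Suc k * A) = tm_factor i (2 ^ k * a) \<or>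
      Suc a = 2 * A \<and> tm_factor i (2 ^ Suc k * A) = tm_factor i (2 ^ k * a) @ block k (tm a)"
    "b = 2 * B \<and> tm_factor (2 ^ Suc k * B) (i + n) = tm_factor (2 ^ k * b) (i + n) \<or>
      b = Suc (2 * B) \<and>
      tm_factor (2 ^ Suc k * B) (i + n) = block k (tm (2 * B)) @ tm_factor (2 ^ k * b) (i + n)"
    using aligned_refine[OF Suc.prems(1,3)] .
  obtain a' b' where ab': "aligned k j n a' b'" "a' < b'"
    "a' = 2 * A' \<and> tm_factor j (2 ^ Suc k * A') = tm_factor j (2 ^ k * a') \<or>
      Suc a' = 2 * A' \<and> tm_factor j (2 ^ Suc k * A') = tm_factor j (2 ^ k * a') @ block k (tm a')"
    "b' = 2 * B' \<and> tm_factor (2 ^ Suc k * B') (j + n) = tm_factor (2 ^ k * b') (j + n) \<or>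
      b' = Suc (2 * B') \<and>
      tm_factor (2 ^ Suc k * B') (j + n) = block k (tm (2 * B')) @ tm_factor (2 ^ k * b') (j + n)"
    using aligned_refine[OF Suc.prems(2,3)] .
  have eq: "eq_upto (k + 2) (magnus (tm_factor i (i + n))) (magnus (tm_factor j (j + n)))"
    using Suc.prems(5) by (simp add: binom_equiv_iff)
  have "binom_equiv k (tm_factor i (i + n)) (tm_factor j (j + n))"
    using Suc.prems(5) by (simp add: binom_equiv_def)
  moreover have "2 ^ k - 1 \<le> n"
    using Suc.prems(3) by simp
  ultimately have IH: "pair_equiv k (tm_factor i (2 ^ k * a), tm_factor (2 ^ k * b) (i + n))
    (tm_factor j (2 ^ k * a'), tm_factor (2 ^ k * b') (j + n))"
    using Suc.IH[OF ab(1) ab'(1)] Suc.prems(4) by blast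
  \<comment> \<open>Agreement through degree \<open>k + 1\<close> sharpens the equivalence of the
    pairs of order \<open>k\<close> to equality. At order 0 the borders are empty.\<close>
  have same: "tm_factor j (2 ^ k * a') = tm_factor i (2 ^ k * a)
    \<and> tm_factor (2 ^ k * b') (j + n) = tm_factor (2 ^ k * b) (i + n)"
  proof (cases k)
    case 0
    then show ?thesis
      using aligned_length_less[OF ab(1)] aligned_length_less[OF ab'(1)]
      by (simp add: tm_factor_def)
  next
    case (Suc l)
    have n: "2 ^ (l + 2) - 1 \<le> n"
      using Suc.prems(3) Suc by simp
    note al = ab(1)[unfolded Suc] ab'(1)[unfolded Suc]
    have eq': "eq_upto (l + 3) (magnus (tm_factor i (i + n))) (magnus (tm_factor j (j + n)))"
      using eq Suc by (simp add: eval_nat_numeral)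
    show ?thesis
      using IH[unfolded Suc]
    proof (cases rule: pair_equiv_elims)
      case eq
      with Suc show ?thesis
        by simp
    next
      case shift
      then show ?thesis
        using shift_impossible[OF al ab(2) ab'(2) n Suc.prems(4) shift eq'] by blast
    next
      case unshift
      then show ?thesis
        using shift_impossible[OF al(2,1) ab'(2) ab(2) n Suc.prems(4) unshift eq_upto_sym[OF eq']]
        by blast
    next
      case swap
      then show ?thesis
        using swap_impossible[OF al ab(2) ab'(2) swap(1,3,2,4) eq'] by blast
    next
      case absorb
      then show ?thesis
        using absorb_impossible[OF al ab(2) ab'(2) absorb eq'] by blast
    next
      case unabsorb
      then show ?thesis
        using absorb_impossible[OF al(2,1) ab'(2) ab(2) unabsorb eq_upto_sym[OF eq']] by blast
    qed
  qed
  have "2 ^ k * (b - a) = 2 ^ k * (b' - a')"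
    using aligned_length[OF ab(1) less_imp_le[OF ab(2)]]
      aligned_length[OF ab'(1) less_imp_le[OF ab'(2)]]
    unfolding same[THEN conjunct1] same[THEN conjunct2] by linarith
  then have m: "b - a = b' - a'"
    unfolding mult_cancel1 by simp
  have "count_list (tm_factor a b) True = count_list (tm_factor a' b') True"
  proof (rule count_eq)
    show "eq_upto (k + 2)
        (magnus (tm_factor i (2 ^ k * a) @ (phi ^^ k) (tm_factor a b) @ tm_factor (2 ^ k * b) (i + n)))
        (magnus (tm_factor i (2 ^ k * a) @ (phi ^^ k) (tm_factor a' b') @ tm_factor (2 ^ k * b) (i + n)))"
      using eq aligned_decomposition[OF ab(1)] aligned_decomposition[OF ab'(1)] ab(2) ab'(2)
      by (simp only: same less_imp_le)
  qed (simp add: m)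
  then show ?case
    using pair_equiv_SucI[OF ab(3,4) ab'(3,4)[unfolded same[THEN conjunct1] same[THEN conjunct2]]
        ab(2) ab'(2) m] aligned_length_less[OF Suc.prems(1)] aligned_length_less[OF Suc.prems(2)]
      aligned_prefix(2)[OF ab(1)] aligned_prefix(2)[OF ab'(1)]
      aligned_suffix[OF ab(1)] aligned_suffix[OF ab'(1)]
    unfolding same[THEN conjunct1] same[THEN conjunct2] by blast
qed

section \<open>The minimal factorization as one induced by an occurrence\<close>

text \<open>The cut set of the factorization comes from an occurrence at some \<open>i\<close>.
  Shifted back by \<open>i\<close>, its least and greatest cuts are the multiples of
  \<open>2 ^ k\<close> that delimit the full blocks.\<close>

lemma min_factorization_aligned:
  assumes "is_tm_factor u" "2 ^ k - 1 \<le> length u"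
  obtains i a b where "u = tm_factor i (i + length u)" "aligned k i (length u) a b"
    and "min_factorization k u = (tm_factor i (2 ^ k * a), tm_factor (2 ^ k * b) (i + length u))"
proof -
  obtain p s where ps: "min_factorization k u = (p, s)"
    by (cases "min_factorization k u")
  then have "is_arg_min (\<lambda>(p, s). length p) (\<lambda>ps. \<exists>C. is_factorization k u C ps) (p, s)"
    using theI'[OF ex1_min_factorization[OF assms]] unfolding min_factorization_def by simp
  then obtain C where C: "is_factorization k u C (p, s)"
    by (auto simp: is_arg_min_def)
  define n where "n = length u"
  define N :: nat where "N = 2 ^ k"
  obtain w where w: "C \<in> Cut k u" "u = p @ (phi ^^ k) w @ s" "length p = Min C"
    "length s = n - Max C"
    using C unfolding is_factorization_def prod.case n_def by blast
  obtain i where i: "u = tm_factor i (i + n)" "C = (\<lambda>m. m - i) ` ({i..i + n} \<inter> {m. N dvd m})"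
    using w(1) by (auto simp: Cut_def n_def N_def)
  have "finite C"
    by (simp add: i)
  have "N > 0"
    by (simp add: N_def)
  \<comment> \<open>Since \<open>N - 1 \<le> n\<close>, the last multiple of \<open>N\<close> up to
    \<open>i + n\<close> is a cut; so \<open>C\<close> is nonempty and contains \<open>Min C\<close>
    and \<open>Max C\<close>.\<close>
  then have "i + n < (i + n) div N * N + N"
    by (metis add_less_cancel_left div_mult_mod_eq mod_less_divisor)
  then have "(i + n) div N * N \<in> {i..i + n} \<inter> {m. N dvd m}"
    using assms(2) by (auto simp: n_def N_def)
  then have "C \<noteq> {}"
    using i by blast
  have mem: "\<exists>d. N * d = i + c \<and> c \<le> n" if "c \<in> C" for c
    using that by (auto simp: i elim!: dvdE)
  obtain a where a: "N * a = i + Min C"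
    using mem[OF Min_in[OF \<open>finite C\<close> \<open>C \<noteq> {}\<close>]] by blast
  obtain b where b: "N * b = i + Max C" "Max C \<le> n"
    using mem[OF Max_in[OF \<open>finite C\<close> \<open>C \<noteq> {}\<close>]] by blast
  have "aligned k i n a b"
    using is_factorization_length_less[OF C] w(3,4) a b
    unfolding aligned_def N_def[symmetric] by linarith
  moreover have "Min C \<le> n"
    using w(2,3) by (simp add: n_def)
  then have "p = tm_factor i (N * a)"
    using w(2,3) i(1) tm_factor_append[of i "N * a" "i + n"] a by (simp add: append_eq_append_conv)
  moreover have "s = tm_factor (N * b) (i + n)"
  proof -
    have "(p @ (phi ^^ k) w) @ s = tm_factor i (N * b) @ tm_factor (N * b) (i + n)"
      using w(2) i(1) tm_factor_append[of i "N * b" "i + n"] b by simp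
    then show ?thesis
      using append_eq_append_conv[of "p @ (phi ^^ k) w" "tm_factor i (N * b)" s
          "tm_factor (N * b) (i + n)"] w(4) b by simp
  qed
  ultimately show thesis
    using that i(1) ps unfolding n_def N_def by metis
qed

theorem theorem7p7:
  fixes k n :: nat and u v :: word
  assumes "k \<ge> 3"
    and "is_tm_factor u" and "is_tm_factor v"
    and "length u = n" and "length v = n"
    and "n \<ge> 2 ^ k - 1"
  shows "binom_equiv k u v \<longleftrightarrow> pair_equiv k (min_factorization k u) (min_factorization k v)"
proof
  \<comment> \<open>This gives \<open>n \<ge> 7\<close> and so rules out the exceptional words of
    length 3.\<close>
  have "(2::nat) ^ 3 \<le> 2 ^ k"
    using assms(1) by (intro power_increasing) simp_all
  then have n: "4 \<le> n"
    using assms(6) by simp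
  obtain i a b where u: "u = tm_factor i (i + n)" "aligned k i n a b"
    "min_factorization k u = (tm_factor i (2 ^ k * a), tm_factor (2 ^ k * b) (i + n))"
    using min_factorization_aligned[OF assms(2), of k] assms(4,6) by blast
  obtain j a' b' where v: "v = tm_factor j (j + n)" "aligned k j n a' b'"
    "min_factorization k v = (tm_factor j (2 ^ k * a'), tm_factor (2 ^ k * b') (j + n))"
    using min_factorization_aligned[OF assms(3), of k] assms(5,6) by blast
  show "pair_equiv k (min_factorization k u) (min_factorization k v)" if "binom_equiv k u v"
    using binom_equiv_imp_pair_equiv[OF u(2) v(2) assms(6) n] that u v by simp
  obtain l where k: "k = Suc l"
    using assms(1) by (cases k) auto
  \<comment> \<open>\<open>2 ^ k * a < i + 2 ^ k \<le> i + n + 1 \<le> 2 ^ k * Suc b\<close>; there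
    may be no full block at all.\<close>
  have le: "a \<le> b" if "aligned k i n a b" for i a b
  proof -
    have "2 ^ k * a < 2 ^ k * Suc b"
      using that assms(6) unfolding aligned_def mult_Suc_right by linarith
    then show ?thesis
      unfolding mult_less_cancel1 by simp
  qed
  show "binom_equiv k u v" if "pair_equiv k (min_factorization k u) (min_factorization k v)"
    using pair_equiv_imp_binom_equiv[OF that[unfolded u(3) v(3), unfolded k],
        of "tm_factor a b" "tm_factor a' b'"]
      aligned_decomposition[OF u(2) le[OF u(2)]] aligned_decomposition[OF v(2) le[OF v(2)]]
      u(1) v(1) assms(4,5) unfolding k by metis
qed

end
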